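(* Let $\rho$ and $\mu$ be probability measures on compact subsets $\mathcal{X}$ and $\mathcal{Y}$ of $\mathbb{R}^d$ respectively, and let $c\in C^1(\mathcal{X}\times\mathcal{Y})$. Assume that $\operatorname{Supp}\rho$ and $\operatorname{Supp}\mu$ are each a finite union of Lipschitz-path connected components, $(A_i)_{i\in I}$ and $(B_j)_{j\in J}$ respectively. Define the bipartite graph $G=(V,E)$ with $V=(A_i)_{i\in I}\cup(B_j)_{j\in J}$ and $$(A_i,B_j)\in E\iff\text{there exists an optimal }\gamma\in\Pi(\rho,\mu)\text{ with }\gamma(A_i\times B_j)>0.$$ If $G$ is connected, then solutions to the dual problem $$\max\left\{\int_{\mathcal{X}}\phi\,\mathrm{d}\rho+\int_{\mathcal{Y}}\psi\,\mathrm{d}\mu\ :\ \phi\in L^1(\rho),\ \psi\in L^1(\mu),\ \phi(x)+\psi(y)\le c(x,y)\ \forall(x,y)\in\mathcal{X}\times\mathcal{Y}\right\}$$ are unique up to a constant: if $(\phi_0,\psi_0)$ and $(\phi_1,\psi_1)$ are optimal, there is $\lambda\in\mathbb{R}$ with $\phi_0=\phi_1+\lambda$ $\rho$-a.e. and $\psi_0=\psi_1-\lambda$ $\mu$-a.e.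
   Context: A set $\Omega\subset\mathbb{R}^d$ is Lipschitz-path connected if any two of its points can be joined by a finite-length curve $\omega:[0,1]\to\Omega$ (without loss of generality Lipschitz); the Lipschitz-path connected components of a set are its maximal Lipschitz-path connected subsets. $\Pi(\rho,\mu)$ is the set of couplings of $\rho$ and $\mu$; optimal means minimising $\int c\,\mathrm{d}\gamma$ over $\Pi(\rho,\mu)$. $c\in C^1(\mathcal{X}\times\mathcal{Y})$ means that $c$ is continuously differentiable (on a neighbourhood of $\mathcal{X}\times\mathcal{Y}$). *)

theory Defs
  imports "Graph_Theory.Digraph_Component" "HOL-Probability.Probability"
begin

definition finite_length :: "(real \<Rightarrow> 'a::metric_space) \<Rightarrow> bool" where
  "finite_length w \<longleftrightarrow>
     (\<exists>L. \<forall>(n::nat) (t::nat \<Rightarrow> real). incseq t \<and> range t \<subseteq> {0..1} \<longrightarrow>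
        (\<Sum>k<n. dist (w (t k)) (w (t (Suc k)))) \<le> L)"

definition lipschitz_path_connected :: "'a::metric_space set \<Rightarrow> bool" where
  "lipschitz_path_connected S \<longleftrightarrow>
     (\<forall>x\<in>S. \<forall>y\<in>S. \<exists>w. path w \<and> path_image w \<subseteq> S \<and> pathstart w = x \<and> pathfinish w = y \<and>
        finite_length w)"

definition lipschitz_path_components :: "'a::metric_space set \<Rightarrow> 'a set set" where
  "lipschitz_path_components S =
     {A. A \<subseteq> S \<and> lipschitz_path_connected A \<and>
         (\<forall>B. A \<subseteq> B \<and> B \<subseteq> S \<and> lipschitz_path_connected B \<longrightarrow> B = A)}"

text \<open>
  A Borel probability measure on a set \<open>X\<close> is a measure whose underlying space is \<open>X\<close>, with the
  trace of the Borel sigma-algebra on \<open>X\<close>.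
\<close>

definition borel_prob_on :: "'a::topological_space set \<Rightarrow> 'a measure \<Rightarrow> bool" where
  "borel_prob_on X M \<longleftrightarrow> prob_space M \<and> sets M = sets (restrict_space borel X)"

definition Supp :: "'a::topological_space measure \<Rightarrow> 'a set" where
  "Supp M = {x \<in> space M. \<forall>U. open U \<and> x \<in> U \<longrightarrow> emeasure M (U \<inter> space M) > 0}"

definition C1_near :: "'a::real_normed_vector set \<Rightarrow> ('a \<Rightarrow> real) \<Rightarrow> bool" where
  "C1_near S f \<longleftrightarrow>
     (\<exists>U (f' :: 'a \<Rightarrow> 'a \<Rightarrow>\<^sub>L real). open U \<and> S \<subseteq> U \<and>
        (\<forall>z\<in>U. (f has_derivative blinfun_apply (f' z)) (at z)) \<and> continuous_on U f')"

definition couplings :: "'a measure \<Rightarrow> 'b measure \<Rightarrow> ('a \<times> 'b) measure set" where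
  "couplings \<rho> \<mu> =
     {\<gamma>. sets \<gamma> = sets (\<rho> \<Otimes>\<^sub>M \<mu>) \<and> distr \<gamma> \<rho> fst = \<rho> \<and> distr \<gamma> \<mu> snd = \<mu>}"

definition optimal_coupling ::
    "('a \<times> 'b \<Rightarrow> real) \<Rightarrow> 'a measure \<Rightarrow> 'b measure \<Rightarrow> ('a \<times> 'b) measure \<Rightarrow> bool" where
  "optimal_coupling c \<rho> \<mu> \<gamma> \<longleftrightarrow>
     \<gamma> \<in> couplings \<rho> \<mu> \<and> (\<forall>\<gamma>'\<in>couplings \<rho> \<mu>. (LINT z|\<gamma>. c z) \<le> (LINT z|\<gamma>'. c z))"

text \<open>
  The vertex set is the disjoint union of the two families of components, since a subset of the
  ambient space may be a component of both supports.  Each edge is listed in one orientation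
  only; \<open>Digraph_Component.connected\<close> refers to the symmetric closure of the arcs.
\<close>

definition transport_graph ::
    "('a::metric_space \<times> 'b::metric_space \<Rightarrow> real) \<Rightarrow> 'a measure \<Rightarrow> 'b measure
       \<Rightarrow> ('a set + 'b set) pair_pre_digraph" where
  "transport_graph c \<rho> \<mu> =
     \<lparr> pverts = lipschitz_path_components (Supp \<rho>) <+> lipschitz_path_components (Supp \<mu>),
       parcs = {(Inl A, Inr B) | A B.
         A \<in> lipschitz_path_components (Supp \<rho>) \<and> B \<in> lipschitz_path_components (Supp \<mu>) \<and>
         (\<exists>\<gamma>. optimal_coupling c \<rho> \<mu> \<gamma> \<and> emeasure \<gamma> (A \<times> B) > 0)} \<rparr>"

definition dual_feasible ::
    "('a \<times> 'b \<Rightarrow> real) \<Rightarrow> 'a measure \<Rightarrow> 'b measure \<Rightarrow> ('a \<Rightarrow> real) \<Rightarrow> ('b \<Rightarrow> real) \<Rightarrow> bool" where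
  "dual_feasible c \<rho> \<mu> \<phi> \<psi> \<longleftrightarrow>
     integrable \<rho> \<phi> \<and> integrable \<mu> \<psi> \<and> (\<forall>x\<in>space \<rho>. \<forall>y\<in>space \<mu>. \<phi> x + \<psi> y \<le> c (x, y))"

definition dual_optimal ::
    "('a \<times> 'b \<Rightarrow> real) \<Rightarrow> 'a measure \<Rightarrow> 'b measure \<Rightarrow> ('a \<Rightarrow> real) \<Rightarrow> ('b \<Rightarrow> real) \<Rightarrow> bool" where
  "dual_optimal c \<rho> \<mu> \<phi> \<psi> \<longleftrightarrow>
     dual_feasible c \<rho> \<mu> \<phi> \<psi> \<and>
     (\<forall>\<phi>' \<psi>'. dual_feasible c \<rho> \<mu> \<phi>' \<psi>' \<longrightarrow>
        (LINT x|\<rho>. \<phi>' x) + (LINT y|\<mu>. \<psi>' y) \<le> (LINT x|\<rho>. \<phi> x) + (LINT y|\<mu>. \<psi> y))"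

end

(*
  After replacing the dual solutions by c-transforms, which changes them only on null sets, both
  are continuous and phi_k(x) + psi_k(y) = c(x,y) on a compact contact set K, for k = 0, 1
  simultaneously, where K carries an optimal coupling and projects onto the supports. Along a
  curve w in a component pick (w t, y t) in K and let p t be the gradient of c(., y t) at w t. The
  increments of both phi_k between s and t lie between p s (w t - w s) and p t (w t - w s), up to
  o(norm (w t - w s)). Comparing a rectifiable curve with an inscribed polygon and cutting each
  block into steps of equal length makes the sum of the gaps telescope, so phi_0 - phi_1 is
  constant along w; this avoids Rademacher's theorem. An edge (A,B) of the graph yields a contact
  point in A x B and thus links the constants on A and B.
*)
theory Submission
  imports Defs
begin

section \<open>Increments along rectifiable curves\<close>

text \<open>The contact points \<open>y t\<close> are chosen without any regularity in
  \<open>t\<close>, so the gradients are merely bounded and a gap \<open>p s d - p t d\<close> is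
  only of order \<open>norm d\<close>, too large to be summed in absolute value. Gaps cancel only
  over consecutive steps with one common vector. Hence each chord \<open>d\<close> of length
  \<open>r\<close> is replaced by \<open>r *\<^sub>R u\<close>, with \<open>u\<close> the direction
  of the whole block. The error is at most the square root of
  \<open>2 * norm d * (norm d - d \<bullet> u)\<close>, which does not add up well; Young's
  inequality turns it into \<open>\<eta> * norm d\<close> plus the excess
  \<open>norm d - d \<bullet> u\<close> times \<open>1 / (2 * \<eta>)\<close>. Summed over all steps
  and blocks, the first part is bounded by \<open>\<eta>\<close> times the length of the curve, the
  second by the amount by which the inscribed polygon is too short. A polygon short by at most
  \<open>\<eta>\<^sup>2\<close> makes everything of order \<open>\<eta>\<close>.\<close>

lemma norm_diff_scaled_le:
  fixes d u :: "'a::real_inner"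
  assumes "norm u \<le> 1" and "\<eta> > 0"
  shows "norm (d - norm d *\<^sub>R u) \<le> \<eta> * norm d + (norm d - d \<bullet> u) / (2 * \<eta>)"
proof -
  let ?a = "\<eta> * norm d" and ?b = "(norm d - d \<bullet> u) / (2 * \<eta>)"
  have du: "d \<bullet> u \<le> norm d"
    using norm_cauchy_schwarz[of d u] assms(1) mult_left_mono[of "norm u" 1 "norm d"] by simp
  have "norm d * norm d * (u \<bullet> u) \<le> norm d * norm d * 1"
    using assms(1) by (intro mult_left_mono) (auto simp: dot_square_norm power_le_one)
  then have "(norm (d - norm d *\<^sub>R u))\<^sup>2 \<le> 2 * norm d * (norm d - d \<bullet> u)"
    by (simp add: power2_norm_eq_inner algebra_simps inner_commute)
       (simp add: power2_norm_eq_inner[symmetric] power2_eq_square)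
  \<comment> \<open>The summands are weighted so that \<open>4 * a * b \<le> (a + b)\<^sup>2\<close>
    applies and no square root remains.\<close>
  also have "\<dots> = 4 * ?a * ?b" using assms(2) by (simp add: field_simps)
  also have "\<dots> \<le> (?a + ?b)\<^sup>2"
    using zero_le_power2[of "?a - ?b"] unfolding power2_sum power2_diff by linarith
  finally have "(norm (d - norm d *\<^sub>R u))\<^sup>2 \<le> (?a + ?b)\<^sup>2" .
  moreover have "?a + ?b \<ge> 0" using du assms(2) by (intro add_nonneg_nonneg) simp_all
  ultimately show ?thesis by (rule power2_le_imp_le)
qed

text \<open>\<open>h\<close> models the difference of two potentials along \<open>w\<close>,
  \<open>p t\<close> the gradient of the cost at a contact point, \<open>v\<close> the arc length.
  The increment bound is one-sided on purpose: \<open>h\<close> and \<open>- h\<close> both satisfy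
  it, and each gives one inequality between the end point values.\<close>

locale gradient_along_curve =
  fixes w :: "real \<Rightarrow> 'a::real_inner" and p :: "real \<Rightarrow> 'a \<Rightarrow> real" and h v :: "real \<Rightarrow> real" and M :: real
  assumes cont: "continuous_on {0..1} w"
    and lin: "\<And>t. linear (p t)"
    and bounded: "\<And>t x. t \<in> {0..1} \<Longrightarrow> \<bar>p t x\<bar> \<le> M * norm x" and M: "M \<ge> 0"
    and increment: "\<And>\<epsilon>. \<epsilon> > 0 \<Longrightarrow> \<exists>\<delta>>0. \<forall>s\<in>{0..1}. \<forall>t\<in>{0..1}. norm (w s - w t) \<le> \<delta> \<longrightarrow>
        h s - h t \<le> p t (w s - w t) - p s (w s - w t) + \<epsilon> * norm (w s - w t)"
    and dist_le: "\<And>s t. 0 \<le> s \<Longrightarrow> s \<le> t \<Longrightarrow> t \<le> 1 \<Longrightarrow> norm (w t - w s) \<le> v t - v s"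
begin

text \<open>
  The curve is traversed in steps of equal length \<open>r\<close>. After replacing each step by \<open>r *\<^sub>R u\<close>, the
  differences of \<open>p\<close> telescope, so that no regularity of \<open>p\<close> in time is needed.
\<close>

lemma block_steps:
  assumes s: "0 \<le> s" "s \<le> b" "b \<le> 1" and r: "r > 0" and u: "norm u \<le> 1" and \<eta>: "\<eta> > 0" and \<epsilon>: "\<epsilon> > 0"
    and inc: "\<forall>s\<in>{0..1}. \<forall>t\<in>{0..1}. norm (w s - w t) \<le> r \<longrightarrow>
        h s - h t \<le> p t (w s - w t) - p s (w s - w t) + \<epsilon> * norm (w s - w t)"
  shows "h b - h s \<le> p s (r *\<^sub>R u) + 3 * M * r + \<epsilon> * (v b - v s)
    + 2 * M * (\<eta> * (v b - v s) + ((v b - v s) - (w b - w s) \<bullet> u) / (2 * \<eta>))"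
proof -
  \<comment> \<open>\<open>k\<close> bounds the number of steps still to come, since a chord of
    length \<open>r\<close> uses up at least \<open>r\<close> of \<open>v\<close>; so
    \<open>k = 0\<close> is contradictory. The starting time \<open>s\<close> moves in the induction
    while \<open>u\<close> stays fixed.\<close>
  obtain k :: nat where "(v b - v s) / r < k" using reals_Archimedean2 by blast
  then have "v b - v s < k * r" using r by (simp add: field_simps)
  then show ?thesis using s
  proof (induction k arbitrary: s)
    case 0
    then show ?case using dist_le[of s b] norm_ge_zero[of "w b - w s"] by simp
  next
    case (Suc k)
    show ?case
    proof (cases "\<exists>t\<in>{s..b}. norm (w t - w s) \<ge> r")
      case True
      then obtain t where t: "t \<in> {s..b}" "norm (w t - w s) \<ge> r" by blast
      \<comment> \<open>The step gets chord length exactly \<open>r\<close>, so that the substitute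
        \<open>r *\<^sub>R u\<close> is the same vector in every step and its gradient terms
        telescope.\<close>
      have "\<exists>t'. s \<le> t' \<and> t' \<le> t \<and> norm (w t' - w s) = r"
        using t r Suc.prems
        by (intro IVT') (auto intro!: continuous_intros continuous_on_subset[OF cont])
      then obtain t' where t': "s \<le> t'" "t' \<le> t" "norm (w t' - w s) = r" by blast
      define d where "d = w t' - w s"
      have nd: "norm d = r" using t' by (simp add: d_def)
      have vd: "r \<le> v t' - v s" using dist_le[of s t'] t' t Suc.prems by auto
      have "v b - v t' < k * r" using vd Suc.prems by (simp add: algebra_simps)
      from Suc.IH[OF this] have IH: "h b - h t' \<le> p t' (r *\<^sub>R u) + 3 * M * r + \<epsilon> * (v b - v t')
         + 2 * M * (\<eta> * (v b - v t') + ((v b - v t') - (w b - w t') \<bullet> u) / (2 * \<eta>))"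
        using t' t Suc.prems by auto
      define e where "e = d - r *\<^sub>R u"
      have d: "d = r *\<^sub>R u + e" by (simp add: e_def)
      have pd: "p x d = p x (r *\<^sub>R u) + p x e" for x using linear_add[OF lin] d by metis
      have "norm e \<le> \<eta> * r + (r - d \<bullet> u) / (2 * \<eta>)"
        using norm_diff_scaled_le[OF u \<eta>, of d] by (simp add: e_def nd)
      also have "\<dots> \<le> \<eta> * (v t' - v s) + ((v t' - v s) - d \<bullet> u) / (2 * \<eta>)"
        using vd \<eta> by (intro add_mono mult_left_mono divide_right_mono) auto
      finally have ne: "M * norm e \<le> M * (\<eta> * (v t' - v s) + ((v t' - v s) - d \<bullet> u) / (2 * \<eta>))"
        using M by (intro mult_left_mono)
      have "h t' - h s \<le> p s d - p t' d + \<epsilon> * norm d"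
        using inc t' t Suc.prems unfolding d_def by auto
      also have "\<dots> = p s (r *\<^sub>R u) - p t' (r *\<^sub>R u) + (p s e - p t' e) + \<epsilon> * r"
        by (simp add: pd nd)
      also have "p s e - p t' e \<le> 2 * (M * norm e)"
        using bounded[of s e] bounded[of t' e] t' t Suc.prems by auto
      also have "\<epsilon> * r \<le> \<epsilon> * (v t' - v s)" using vd \<epsilon> by simp
      finally have st: "h t' - h s \<le> p s (r *\<^sub>R u) - p t' (r *\<^sub>R u) + 2 * (M * norm e) + \<epsilon> * (v t' - v s)"
        by simp
      \<comment> \<open>The increment of \<open>v\<close> minus the displacement along
        \<open>u\<close> is additive under concatenation, so the error of this step and that of the
        induction hypothesis add up exactly.\<close>
      have split: "(w b - w s) \<bullet> u = (w b - w t') \<bullet> u + d \<bullet> u" by (simp add: d_def inner_diff_left)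
      have "\<epsilon> * (v b - v s) = \<epsilon> * (v b - v t') + \<epsilon> * (v t' - v s)"
        "2 * M * (\<eta> * (v b - v s) + ((v b - v s) - (w b - w s) \<bullet> u) / (2 * \<eta>)) =
         2 * M * (\<eta> * (v b - v t') + ((v b - v t') - (w b - w t') \<bullet> u) / (2 * \<eta>)) +
         2 * (M * (\<eta> * (v t' - v s) + ((v t' - v s) - d \<bullet> u) / (2 * \<eta>)))"
        using \<eta> unfolding split by (simp_all add: field_simps)
      then show ?thesis using IH st ne by linarith
    next
      case False
      \<comment> \<open>The last step is shorter than \<open>r\<close> and is estimated crudely: its
        gap costs at most \<open>2 * M * r\<close>, and the term \<open>p s (r *\<^sub>R u)\<close>
        in the claim is at least \<open>- M * r\<close>. This is the origin of
        \<open>3 * M * r\<close>.\<close>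
      define d where "d = w b - w s"
      have "b \<in> {s..b}" using Suc.prems by simp
      then have "\<not> r \<le> norm (w b - w s)" using False by blast
      then have nd: "norm d \<le> r" by (simp add: d_def)
      have vd: "norm d \<le> v b - v s" using dist_le[of s b] Suc.prems by (auto simp: d_def)
      have du: "d \<bullet> u \<le> norm d"
        using norm_cauchy_schwarz[of d u] u mult_left_mono[of "norm u" 1 "norm d"] by simp
      have "h b - h s \<le> p s d - p b d + \<epsilon> * norm d"
        using inc Suc.prems nd unfolding d_def by auto
      moreover have "p s d - p b d \<le> 2 * (M * norm d)"
        using bounded[of s d] bounded[of b d] Suc.prems by auto
      moreover have "M * norm d \<le> M * r" using nd M by (intro mult_left_mono)
      moreover have "\<epsilon> * norm d \<le> \<epsilon> * (v b - v s)" using vd \<epsilon> by simp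
      moreover have "- (p s (r *\<^sub>R u)) \<le> M * r"
      proof -
        have "- (p s (r *\<^sub>R u)) \<le> M * norm (r *\<^sub>R u)" using bounded[of s "r *\<^sub>R u"] Suc.prems by auto
        also have "\<dots> \<le> M * r" using M u r by (intro mult_left_mono) auto
        finally show ?thesis .
      qed
      moreover have "0 \<le> 2 * M * (\<eta> * (v b - v s) + ((v b - v s) - d \<bullet> u) / (2 * \<eta>))"
        using M \<eta> vd du norm_ge_zero[of d] by (intro mult_nonneg_nonneg add_nonneg_nonneg divide_nonneg_pos) linarith+
      ultimately show ?thesis unfolding d_def by linarith
    qed
  qed
qed

text \<open>As the step length tends to 0, the boundary terms of \<open>block_steps\<close> vanish.
  The choice \<open>u = sgn (w b - w a)\<close> turns the inner product into the chord length; it is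
  0 for a closed block, which is why \<open>u\<close> is only required to have norm at most
  1.\<close>

lemma block_increment:
  assumes ab: "0 \<le> a" "a \<le> b" "b \<le> 1" and \<eta>: "\<eta> > 0"
  shows "h b - h a \<le> 2 * M * (\<eta> * (v b - v a) + ((v b - v a) - norm (w b - w a)) / (2 * \<eta>))"
    (is "_ \<le> ?R")
proof (rule field_le_epsilon)
  fix e :: real assume e: "e > 0"
  \<comment> \<open>\<open>3 * M\<close> comes from \<open>block_steps\<close>, one more
    \<open>M\<close> from \<open>p a (r *\<^sub>R u)\<close>, and the summand 1 keeps
    \<open>K\<close> positive.\<close>
  define K where "K = 4 * M + (v b - v a) + 1"
  have v0: "v b - v a \<ge> 0" using dist_le[OF ab] norm_ge_zero[of "w b - w a"] by linarith
  have K: "K > 0" using v0 M by (simp add: K_def)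
  define \<epsilon> where "\<epsilon> = e / K"
  have \<epsilon>: "\<epsilon> > 0" using e K by (simp add: \<epsilon>_def)
  obtain \<delta> where \<delta>: "\<delta> > 0" and inc: "\<forall>s\<in>{0..1}. \<forall>t\<in>{0..1}. norm (w s - w t) \<le> \<delta> \<longrightarrow>
        h s - h t \<le> p t (w s - w t) - p s (w s - w t) + \<epsilon> * norm (w s - w t)"
    using increment[OF \<epsilon>] by blast
  define r where "r = min \<delta> \<epsilon>"
  define u where "u = sgn (w b - w a)"
  have r: "r > 0" "r \<le> \<epsilon>" "r \<le> \<delta>" using \<delta> \<epsilon> by (auto simp: r_def)
  have u: "norm u \<le> 1" by (simp add: u_def norm_sgn)
  have wu: "(w b - w a) \<bullet> u = norm (w b - w a)"
    by (cases "w b = w a") (simp_all add: u_def sgn_div_norm dot_square_norm power2_eq_square)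
  have "h b - h a \<le> p a (r *\<^sub>R u) + 3 * M * r + \<epsilon> * (v b - v a) + ?R"
    using block_steps[OF ab r(1) u \<eta> \<epsilon>, unfolded wu] inc r by force
  moreover have "p a (r *\<^sub>R u) \<le> M * r"
  proof -
    have "p a (r *\<^sub>R u) \<le> M * norm (r *\<^sub>R u)" using bounded[of a "r *\<^sub>R u"] ab by auto
    also have "\<dots> \<le> M * r" using M u r by (intro mult_left_mono) auto
    finally show ?thesis .
  qed
  moreover have "M * r \<le> M * \<epsilon>" using r M by (intro mult_left_mono)
  moreover have "4 * (M * \<epsilon>) + \<epsilon> * (v b - v a) \<le> \<epsilon> * K" using \<epsilon> by (simp add: K_def algebra_simps)
  moreover have "\<epsilon> * K = e" using K by (simp add: \<epsilon>_def)
  ultimately show "h b - h a \<le> ?R + e" by linarith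
qed

lemma endpoint_le:
  assumes rect: "\<And>\<epsilon>. \<epsilon> > 0 \<Longrightarrow> \<exists>n q. incseq q \<and> range q \<subseteq> {0..1} \<and>
      v 1 - v 0 - \<epsilon> \<le> (\<Sum>k<n. norm (w (q (Suc k)) - w (q k)))"
  shows "h 1 \<le> h 0"
proof -
  have v0: "v 1 - v 0 \<ge> 0" using dist_le[of 0 1] norm_ge_zero[of "w 1 - w 0"] by linarith
  have bound: "h 1 - h 0 \<le> 2 * M * (\<eta> * (v 1 - v 0) + \<eta> / 2)" if \<eta>: "\<eta> > 0" for \<eta>
  proof -
    \<comment> \<open>The defect of the polygon gets multiplied by \<open>1 / (2 * \<eta>)\<close>;
      the tolerance \<open>\<eta>\<^sup>2\<close> leaves \<open>\<eta> / 2\<close>.\<close>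
    have "\<eta>\<^sup>2 > 0" using \<eta> by simp
    from rect[OF this] obtain n q where q: "incseq q" "range q \<subseteq> {0..1}"
      and len: "v 1 - v 0 - \<eta>\<^sup>2 \<le> (\<Sum>k<n. norm (w (q (Suc k)) - w (q k)))" by blast
    have q01: "0 \<le> q k" "q k \<le> 1" for k using q(2) by (auto simp: image_subset_iff)
    have sum: "h (q n) - h (q 0) \<le> 2 * M * (\<eta> * (v (q n) - v (q 0)) +
        ((v (q n) - v (q 0)) - (\<Sum>k<n. norm (w (q (Suc k)) - w (q k)))) / (2 * \<eta>))"
    proof -
      have "h (q n) - h (q 0) = (\<Sum>k<n. h (q (Suc k)) - h (q k))"
        by (rule sum_lessThan_telescope[symmetric])
      also have "\<dots> \<le> (\<Sum>k<n. 2 * M * (\<eta> * (v (q (Suc k)) - v (q k)) +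
         ((v (q (Suc k)) - v (q k)) - norm (w (q (Suc k)) - w (q k))) / (2 * \<eta>)))"
        using q01 q(1) by (intro sum_mono block_increment \<eta>) (auto simp: incseq_Suc_iff)
      also have "\<dots> = 2 * M * (\<eta> * (\<Sum>k<n. v (q (Suc k)) - v (q k)) +
         ((\<Sum>k<n. v (q (Suc k)) - v (q k)) - (\<Sum>k<n. norm (w (q (Suc k)) - w (q k)))) / (2 * \<eta>))"
        by (simp only: sum_distrib_left[symmetric] sum.distrib sum_divide_distrib[symmetric] sum_subtractf)
      finally show ?thesis unfolding sum_lessThan_telescope[of "\<lambda>k. v (q k)"] .
    qed
    \<comment> \<open>The nodes need not start at 0 or end at 1. On the two outer pieces the chord
      is discarded, so that their whole arc length counts as excess, in accordance with the polygon
      having no edges there.\<close>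
    have drop: "2 * M * (\<eta> * x + (x - y) / (2 * \<eta>)) \<le> 2 * M * (\<eta> * x + x / (2 * \<eta>))" if "y \<ge> 0" for x y
      using that M \<eta> by (intro mult_left_mono add_left_mono divide_right_mono) auto
    have first: "h (q 0) - h 0 \<le> 2 * M * (\<eta> * (v (q 0) - v 0) + (v (q 0) - v 0) / (2 * \<eta>))"
      using block_increment[of 0 "q 0", OF _ _ _ \<eta>] drop[of "norm (w (q 0) - w 0)" "v (q 0) - v 0"] q01[of 0] by simp
    have last: "h 1 - h (q n) \<le> 2 * M * (\<eta> * (v 1 - v (q n)) + (v 1 - v (q n)) / (2 * \<eta>))"
      using block_increment[of "q n" 1, OF _ _ _ \<eta>] drop[of "norm (w 1 - w (q n))" "v 1 - v (q n)"] q01[of n] by simp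
    let ?S = "\<Sum>k<n. norm (w (q (Suc k)) - w (q k))"
    have "2 * M * (\<eta> * (v 1 - v (q n)) + (v 1 - v (q n)) / (2 * \<eta>)) +
      2 * M * (\<eta> * (v (q n) - v (q 0)) + ((v (q n) - v (q 0)) - ?S) / (2 * \<eta>)) +
      2 * M * (\<eta> * (v (q 0) - v 0) + (v (q 0) - v 0) / (2 * \<eta>)) =
      2 * M * (\<eta> * (v 1 - v 0) + ((v 1 - v 0) - ?S) / (2 * \<eta>))"
      using \<eta> by (simp add: field_simps)
    then have "h 1 - h 0 \<le> 2 * M * (\<eta> * (v 1 - v 0) + ((v 1 - v 0) - ?S) / (2 * \<eta>))"
      using first last sum by linarith
    also have "\<dots> \<le> 2 * M * (\<eta> * (v 1 - v 0) + \<eta>\<^sup>2 / (2 * \<eta>))"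
      using len M \<eta> by (intro mult_left_mono add_left_mono divide_right_mono) auto
    also have "\<eta>\<^sup>2 / (2 * \<eta>) = \<eta> / 2" using \<eta> by (simp add: power2_eq_square)
    finally show ?thesis .
  qed
  have "h 1 - h 0 \<le> 0"
  proof (rule field_le_epsilon)
    fix e :: real assume e: "e > 0"
    define K where "K = 2 * M * ((v 1 - v 0) + 1 / 2) + 1"
    have K: "K > 0" using M v0 by (simp add: K_def add_nonneg_pos)
    have "h 1 - h 0 \<le> 2 * M * (e / K * (v 1 - v 0) + (e / K) / 2)" using e K by (intro bound) simp
    also have "\<dots> = e / K * (K - 1)"
    proof -
      have "2 * M * (x * (v 1 - v 0) + x / 2) = x * (K - 1)" for x by (simp add: K_def algebra_simps)
      then show ?thesis .
    qed
    also have "\<dots> \<le> 0 + e" using e K by (simp add: field_simps)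
    finally show "h 1 - h 0 \<le> 0 + e" .
  qed
  then show ?thesis by simp
qed

end

section \<open>The arc length function of a curve of finite length\<close>

lemma finite_length_arc_length:
  fixes w :: "real \<Rightarrow> 'a::metric_space"
  assumes "finite_length w"
  obtains v where "\<And>s t. 0 \<le> s \<Longrightarrow> s \<le> t \<Longrightarrow> t \<le> 1 \<Longrightarrow> dist (w t) (w s) \<le> v t - v s"
    and "\<And>\<epsilon>. \<epsilon> > 0 \<Longrightarrow> \<exists>n q. incseq q \<and> range q \<subseteq> {0..1} \<and>
      v 1 - v 0 - \<epsilon> \<le> (\<Sum>k<n. dist (w (q (Suc k))) (w (q k)))"
proof -
  \<comment> \<open>The sequences need not reach the end points of \<open>{0..t}\<close>, so a
    sequence for \<open>s\<close> is admissible for every later \<open>t\<close> and can be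
    prolonged there.\<close>
  define P where "P t = {(\<Sum>k<n. dist (w (q k)) (w (q (Suc k)))) | n q. incseq q \<and> range q \<subseteq> {0..t}}" for t :: real
  define v where "v t = Sup (P t)" for t
  obtain L where L: "\<And>n q. incseq q \<Longrightarrow> range q \<subseteq> {0..1} \<Longrightarrow> (\<Sum>k<n. dist (w (q k)) (w (q (Suc k)))) \<le> L"
    using assms unfolding finite_length_def by blast
  have bdd: "bdd_above (P t)" if "t \<le> 1" for t
  proof (rule bdd_aboveI[of _ L])
    fix x assume "x \<in> P t"
    then obtain n q where x: "x = (\<Sum>k<n. dist (w (q k)) (w (q (Suc k))))" and q: "incseq q" "range q \<subseteq> {0..t}"
      by (auto simp: P_def)
    have "range q \<subseteq> {0..1}" using q(2) that by (auto simp: image_subset_iff intro: order_trans)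
    then show "x \<le> L" using L q(1) x by blast
  qed
  have zero: "0 \<in> P t" if "0 \<le> t" for t
    unfolding P_def using that by (auto intro!: exI[of _ "0::nat"] exI[of _ "\<lambda>_. 0"])
  have step: "v s \<le> v t - dist (w t) (w s)" if st: "0 \<le> s" "s \<le> t" "t \<le> 1" for s t
    unfolding v_def
  proof (rule cSup_least)
    show "P s \<noteq> {}" using zero st by blast
    fix x assume "x \<in> P s"
    then obtain n q where x: "x = (\<Sum>k<n. dist (w (q k)) (w (q (Suc k))))" and q: "incseq q" "range q \<subseteq> {0..s}"
      by (auto simp: P_def)
    \<comment> \<open>The nodes \<open>s\<close> and \<open>t\<close> follow \<open>q n\<close>.
      Summing up to \<open>Suc (Suc n)\<close> thus adds the two chords from \<open>q n\<close> to
      \<open>s\<close> and from \<open>s\<close> to \<open>t\<close>; only the second one is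
      kept.\<close>
    define q' where "q' k = (if k \<le> n then q k else if k = Suc n then s else t)" for k
    have qs: "0 \<le> q k" "q k \<le> s" for k using q(2) by (auto simp: image_subset_iff)
    have "incseq q'" using q(1) qs st unfolding incseq_Suc_iff by (auto simp: q'_def not_le)
    moreover have "range q' \<subseteq> {0..t}" using qs st by (auto simp: q'_def intro: order_trans[OF qs(2)])
    ultimately have "(\<Sum>k<Suc (Suc n). dist (w (q' k)) (w (q' (Suc k)))) \<in> P t" unfolding P_def by blast
    then have "(\<Sum>k<Suc (Suc n). dist (w (q' k)) (w (q' (Suc k)))) \<le> Sup (P t)"
      using bdd st by (intro cSup_upper) auto
    moreover have "(\<Sum>k<n. dist (w (q' k)) (w (q' (Suc k)))) = x"
      unfolding x by (intro sum.cong) (auto simp: q'_def)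
    ultimately have "x + dist (w (q' n)) (w s) + dist (w s) (w t) \<le> Sup (P t)"
      by (simp add: q'_def)
    then show "x \<le> Sup (P t) - dist (w t) (w s)"
      using zero_le_dist[of "w (q' n)" "w s"] dist_commute[of "w s" "w t"] by linarith
  qed
  show thesis
  proof (rule that[of v])
    show "dist (w t) (w s) \<le> v t - v s" if "0 \<le> s" "s \<le> t" "t \<le> 1" for s t
      using step[OF that] by simp
    fix \<epsilon> :: real assume "\<epsilon> > 0"
    have v0: "v 0 \<ge> 0" unfolding v_def using bdd[of 0] zero[of 0] by (intro cSup_upper) auto
    have "\<exists>x\<in>P 1. Sup (P 1) - \<epsilon> < x" using less_cSup_iff[of "P 1" "Sup (P 1) - \<epsilon>"] bdd[of 1] zero[of 1] \<open>\<epsilon> > 0\<close> by auto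
    then obtain n q where "incseq q" "range q \<subseteq> {0..1}" "Sup (P 1) - \<epsilon> < (\<Sum>k<n. dist (w (q k)) (w (q (Suc k))))"
      by (auto simp: P_def)
    then show "\<exists>n q. incseq q \<and> range q \<subseteq> {0..1} \<and>
      v 1 - v 0 - \<epsilon> \<le> (\<Sum>k<n. dist (w (q (Suc k))) (w (q k)))"
      using v0 by (intro exI[of _ n] exI[of _ q]) (auto simp: v_def dist_commute)
  qed
qed

text \<open>The bound on the absolute increment does not see the sign of \<open>h\<close>, so
  \<open>endpoint_le\<close> applies to \<open>h\<close> and to \<open>- h\<close> with the same
  gradients.\<close>

lemma endpoint_eq_of_increment_bound:
  fixes w :: "real \<Rightarrow> 'a::real_inner" and h :: "real \<Rightarrow> real"
  assumes "path w" and "finite_length w" and "\<And>t. linear (p t)"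
    and "\<And>t x. t \<in> {0..1} \<Longrightarrow> \<bar>p t x\<bar> \<le> M * norm x" and "M \<ge> 0"
    and inc: "\<And>\<epsilon>. \<epsilon> > 0 \<Longrightarrow> \<exists>\<delta>>0. \<forall>s\<in>{0..1}. \<forall>t\<in>{0..1}. norm (w s - w t) \<le> \<delta> \<longrightarrow>
        \<bar>h s - h t\<bar> \<le> p t (w s - w t) - p s (w s - w t) + \<epsilon> * norm (w s - w t)"
  shows "h 1 = h 0"
proof -
  obtain v where v: "\<And>s t. 0 \<le> s \<Longrightarrow> s \<le> t \<Longrightarrow> t \<le> 1 \<Longrightarrow> dist (w t) (w s) \<le> v t - v s"
    and rect: "\<And>\<epsilon>. \<epsilon> > 0 \<Longrightarrow> \<exists>n q. incseq q \<and> range q \<subseteq> {0..1} \<and>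
      v 1 - v 0 - \<epsilon> \<le> (\<Sum>k<n. dist (w (q (Suc k))) (w (q k)))"
    using finite_length_arc_length[OF assms(2)] by blast
  have loc: "gradient_along_curve w p g v M" if g: "g = h \<or> g = (\<lambda>t. - h t)" for g
  proof (rule gradient_along_curve.intro)
    show "continuous_on {0..1} w" using assms(1) by (simp add: path_def)
    show "\<exists>\<delta>>0. \<forall>s\<in>{0..1}. \<forall>t\<in>{0..1}. norm (w s - w t) \<le> \<delta> \<longrightarrow>
        g s - g t \<le> p t (w s - w t) - p s (w s - w t) + \<epsilon> * norm (w s - w t)" if "\<epsilon> > 0" for \<epsilon>
    proof -
      obtain \<delta> where "\<delta> > 0" and \<delta>: "\<And>s t. s \<in> {0..1} \<Longrightarrow> t \<in> {0..1} \<Longrightarrow> norm (w s - w t) \<le> \<delta> \<Longrightarrow>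
        \<bar>h s - h t\<bar> \<le> p t (w s - w t) - p s (w s - w t) + \<epsilon> * norm (w s - w t)"
        using inc[OF \<open>\<epsilon> > 0\<close>] by blast
      have "g s - g t \<le> \<bar>h s - h t\<bar>" for s t using g by auto
      then show ?thesis using \<open>\<delta> > 0\<close> \<delta> by (meson order_trans)
    qed
    show "linear (p t)" for t by fact
  qed (use assms v in \<open>auto simp: dist_norm\<close>)
  have "g 1 \<le> g 0" if "g = h \<or> g = (\<lambda>t. - h t)" for g
    using rect by (intro gradient_along_curve.endpoint_le[OF loc[OF that]]) (simp add: dist_norm)
  from this[of h] this[of "\<lambda>t. - h t"] show ?thesis by simp
qed

section \<open>Uniform first-order expansion on compact sets\<close>

lemma C1_near_compact_expansion:
  fixes f :: "'a::real_normed_vector \<Rightarrow> real"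
  assumes "C1_near S f" and "compact S"
  obtains f' :: "'a \<Rightarrow> 'a \<Rightarrow>\<^sub>L real" and M where "M \<ge> 0" and "\<And>z. z \<in> S \<Longrightarrow> norm (f' z) \<le> M"
    and "\<And>\<epsilon>. \<epsilon> > 0 \<Longrightarrow> \<exists>\<delta>>0. \<forall>x\<in>S. \<forall>y\<in>S. norm (y - x) \<le> \<delta> \<longrightarrow>
      \<bar>f y - f x - f' x (y - x)\<bar> \<le> \<epsilon> * norm (y - x)"
    and "continuous_on S f"
proof -
  obtain U and f' :: "'a \<Rightarrow> 'a \<Rightarrow>\<^sub>L real" where U: "open U" "S \<subseteq> U"
    and der: "\<And>z. z \<in> U \<Longrightarrow> (f has_derivative f' z) (at z)" and cont: "continuous_on U f'"
    using assms(1) unfolding C1_near_def by blast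
  have "bounded (f' ` S)"
    using assms(2) cont U(2) by (intro compact_imp_bounded compact_continuous_image continuous_on_subset[OF cont]) auto
  then obtain M where M: "M > 0" "\<And>z. z \<in> S \<Longrightarrow> norm (f' z) \<le> M"
    unfolding bounded_pos by auto
  show thesis
  proof (rule that[of M f'])
    fix \<epsilon> :: real assume \<epsilon>: "\<epsilon> > 0"
    \<comment> \<open>A Lebesgue number of this cover puts two nearby points of \<open>S\<close>
      into one ball inside \<open>U\<close> on which the derivative hardly varies. Balls are convex,
      so the segment between the points is available although \<open>S\<close> and \<open>U\<close>
      may fail to be convex.\<close>
    define \<G> where "\<G> = {ball z r | z r. ball z r \<subseteq> U \<and> (\<forall>x\<in>ball z r. norm (f' x - f' z) \<le> \<epsilon> / 2)}"
    have "S \<subseteq> \<Union>\<G>"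
    proof
      fix z assume "z \<in> S"
      then have z: "z \<in> U" using U by blast
      obtain r1 where r1: "r1 > 0" "ball z r1 \<subseteq> U" using U(1) z open_contains_ball by blast
      have "continuous (at z) f'" using cont U(1) z by (simp add: continuous_on_eq_continuous_at)
      then obtain r2 where r2: "r2 > 0" "\<And>x. dist x z < r2 \<Longrightarrow> dist (f' x) (f' z) < \<epsilon> / 2"
        using \<epsilon> unfolding continuous_at_eps_delta by (meson half_gt_zero)
      have "ball z (min r1 r2) \<in> \<G>"
        unfolding \<G>_def using r1 r2
        by (intro CollectI exI[of _ z] exI[of _ "min r1 r2"]) (auto simp: dist_norm norm_minus_commute less_imp_le subset_iff)
      then show "z \<in> \<Union>\<G>" using r1 r2 by (auto intro!: bexI[of _ "ball z (min r1 r2)"])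
    qed
    moreover have "open G" if "G \<in> \<G>" for G using that by (auto simp: \<G>_def)
    ultimately obtain e where e: "e > 0" "\<And>x. x \<in> S \<Longrightarrow> \<exists>G\<in>\<G>. ball x e \<subseteq> G"
      using Heine_Borel_lemma[OF assms(2)] by metis
    show "\<exists>\<delta>>0. \<forall>x\<in>S. \<forall>y\<in>S. norm (y - x) \<le> \<delta> \<longrightarrow>
      \<bar>f y - f x - f' x (y - x)\<bar> \<le> \<epsilon> * norm (y - x)"
    proof (intro exI[of _ "e / 2"] conjI ballI impI)
      show "e / 2 > 0" using e by simp
      fix x y assume xy: "x \<in> S" "y \<in> S" "norm (y - x) \<le> e / 2"
      from e(2)[OF xy(1)] obtain z r where sub: "ball x e \<subseteq> ball z r" "ball z r \<subseteq> U"
        and osc: "\<And>x. x \<in> ball z r \<Longrightarrow> norm (f' x - f' z) \<le> \<epsilon> / 2"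
        unfolding \<G>_def by blast
      have x: "x \<in> ball z r" and y: "y \<in> ball z r"
        using e xy(3) by (auto intro!: subsetD[OF sub(1)] simp: dist_norm norm_minus_commute simp del: mem_ball)
          (auto simp: dist_norm norm_minus_commute)
      have "norm (f y - f x - f' x (y - x)) \<le> norm (y - x) * \<epsilon>"
      proof (rule differentiable_bound_linearization[where S = "ball z r"])
        show "x + t *\<^sub>R (y - x) \<in> ball z r" if "t \<in> {0..1}" for t
        proof -
          have "x + t *\<^sub>R (y - x) = (1 - t) *\<^sub>R x + t *\<^sub>R y" by (simp add: algebra_simps)
          then show ?thesis using convexD[OF convex_ball x y, of "1 - t" t] that by simp
        qed
        show "(f has_derivative f' x) (at x within ball z r)" if "x \<in> ball z r" for x
          using der that sub(2) by (blast intro: has_derivative_at_withinI)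
        show "onorm (blinfun_apply (f' u) - blinfun_apply (f' x)) \<le> \<epsilon>" if "u \<in> ball z r" for u
        proof -
          have "onorm (blinfun_apply (f' u) - blinfun_apply (f' x)) = norm (f' u - f' x)"
            by (simp add: norm_blinfun.rep_eq minus_blinfun.rep_eq fun_diff_def)
          also have "\<dots> \<le> norm (f' u - f' z) + norm (f' x - f' z)"
            using norm_triangle_ineq4[of "f' u - f' z" "f' x - f' z"] by simp
          finally show ?thesis using osc[OF that] osc[OF x] by linarith
        qed
      qed fact
      then show "\<bar>f y - f x - f' x (y - x)\<bar> \<le> \<epsilon> * norm (y - x)"
        by (simp only: real_norm_def mult.commute[of \<epsilon>])
    qed
  next
    show "continuous_on S f"
    proof (rule has_derivative_continuous_on)
      show "(f has_derivative f' x) (at x within S)" if "x \<in> S" for x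
        using der that U(2) by (blast intro: has_derivative_at_withinI)
    qed
  qed (use M in auto)
qed

section \<open>Existence of components and full measure of the support\<close>

lemma lipschitz_path_components_cover:
  fixes S :: "'a::metric_space set"
  assumes "x \<in> S"
  obtains A where "A \<in> lipschitz_path_components S" and "x \<in> A"
proof -
  define \<A> where "\<A> = {A. x \<in> A \<and> A \<subseteq> S \<and> lipschitz_path_connected A}"
  have "lipschitz_path_connected {x}"
    unfolding lipschitz_path_connected_def
  proof (intro ballI)
    fix y z assume "y \<in> {x}" "z \<in> {x}"
    moreover have "finite_length (\<lambda>_. x)" unfolding finite_length_def by (intro exI[of _ 0]) simp
    ultimately show "\<exists>w. path w \<and> path_image w \<subseteq> {x} \<and> pathstart w = y \<and> pathfinish w = z \<and> finite_length w"
      by (intro exI[of _ "\<lambda>_. x"]) (auto simp: path_def path_image_def pathstart_def pathfinish_def)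
  qed
  then have ne: "\<A> \<noteq> {}" using assms by (auto simp: \<A>_def)
  \<comment> \<open>Two points of the union of a chain lie in one member of the chain, and a curve
    in that member joins them; so Zorn's lemma yields a maximal connected set.\<close>
  have "\<exists>A\<in>\<A>. \<forall>B\<in>\<A>. A \<subseteq> B \<longrightarrow> B = A"
  proof (rule subset_Zorn_nonempty[OF ne])
    fix \<C> assume C: "\<C> \<noteq> {}" "subset.chain \<A> \<C>"
    have sub: "\<C> \<subseteq> \<A>" using C(2) by (simp add: subset.chain_def)
    have "lipschitz_path_connected (\<Union>\<C>)"
      unfolding lipschitz_path_connected_def
    proof (intro ballI)
      fix y z assume "y \<in> \<Union>\<C>" "z \<in> \<Union>\<C>"
      then obtain A B where "A \<in> \<C>" "B \<in> \<C>" "y \<in> A" "z \<in> B" by blast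
      moreover have "A \<subseteq> B \<or> B \<subseteq> A" using C(2) calculation by (auto simp: subset.chain_def)
      ultimately obtain D where D: "D \<in> \<C>" "y \<in> D" "z \<in> D" by blast
      then have "lipschitz_path_connected D" using sub by (auto simp: \<A>_def)
      then obtain w where "path w" "path_image w \<subseteq> D" "pathstart w = y" "pathfinish w = z" "finite_length w"
        using D unfolding lipschitz_path_connected_def by blast
      then show "\<exists>w. path w \<and> path_image w \<subseteq> \<Union>\<C> \<and> pathstart w = y \<and> pathfinish w = z \<and> finite_length w"
        using D(1) by (intro exI[of _ w]) auto
    qed
    then show "\<Union>\<C> \<in> \<A>" using C(1) sub by (auto simp: \<A>_def)
  qed
  then obtain A where A: "A \<in> \<A>" "\<And>B. B \<in> \<A> \<Longrightarrow> A \<subseteq> B \<Longrightarrow> B = A" by blast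
  then have "A \<in> lipschitz_path_components S" "x \<in> A"
    unfolding lipschitz_path_components_def \<A>_def by blast+
  then show thesis by (rule that)
qed

text \<open>A point off the support has a basic neighbourhood of measure zero, and there are only
  countably many basic sets to discard.\<close>

lemma AE_in_Supp:
  fixes M :: "'a::second_countable_topology measure"
  assumes id: "(\<lambda>x. x) \<in> M \<rightarrow>\<^sub>M borel"
  shows "AE x in M. x \<in> Supp M"
proof -
  obtain B :: "'a set set" where B: "countable B" "topological_basis B" using ex_countable_basis by auto
  define \<N> where "\<N> = {b\<in>B. emeasure M (b \<inter> space M) = 0}"
  have meas: "b \<inter> space M \<in> sets M" if "b \<in> B" for b
    using measurable_sets[OF id borel_open[of b]] topological_basis_open[OF B(2) that] by simp
  have "AE x in M. \<forall>b\<in>\<N>. x \<notin> b"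
  proof (rule AE_ball_countable')
    show "AE x in M. x \<notin> b" if "b \<in> \<N>" for b
      using that meas[of b] AE_not_in[of "b \<inter> space M" M] by (auto simp: \<N>_def null_sets_def)
    show "countable \<N>" using B(1) by (simp add: \<N>_def)
  qed
  then show ?thesis
  proof (rule AE_mp, intro AE_I2 impI)
    fix x assume x: "x \<in> space M" "\<forall>b\<in>\<N>. x \<notin> b"
    show "x \<in> Supp M" unfolding Supp_def
    proof (intro CollectI conjI allI impI)
      fix U assume U: "open U \<and> x \<in> U"
      then obtain b where b: "b \<in> B" "x \<in> b" "b \<subseteq> U" using B(2) topological_basisE by metis
      have "U \<inter> space M \<in> sets M" using measurable_sets[OF id borel_open[of U]] U by simp
      then have "emeasure M (b \<inter> space M) \<le> emeasure M (U \<inter> space M)"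
        using b by (intro emeasure_mono) auto
      moreover have "emeasure M (b \<inter> space M) \<noteq> 0" using x(2) b by (auto simp: \<N>_def)
      ultimately show "emeasure M (U \<inter> space M) > 0"
        by (metis dual_order.strict_trans1 not_gr_zero)
    qed fact
  qed
qed

section \<open>Cyclical monotonicity of optimal couplings\<close>

lemma borel_prob_onD:
  assumes "borel_prob_on X M"
  shows "prob_space M" and "space M = X" and "(\<lambda>x. x) \<in> M \<rightarrow>\<^sub>M borel"
proof -
  have s: "sets M = sets (restrict_space borel X)" using assms by (simp add: borel_prob_on_def)
  show "prob_space M" using assms by (simp add: borel_prob_on_def)
  show "space M = X" using sets_eq_imp_space_eq[OF s] by (simp add: space_restrict_space)
  have "(\<lambda>x. x) \<in> restrict_space borel X \<rightarrow>\<^sub>M borel" by (intro measurable_restrict_space1) simp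
  then show "(\<lambda>x. x) \<in> M \<rightarrow>\<^sub>M borel" using s by (simp cong: measurable_cong_sets)
qed

section \<open>Compact transport problems and their couplings\<close>

locale transport_problem =
  fixes X :: "'a::euclidean_space set" and Y :: "'b::euclidean_space set"
    and \<rho> :: "'a measure" and \<mu> :: "'b measure" and c :: "'a \<times> 'b \<Rightarrow> real"
  assumes compact_X: "compact X" and compact_Y: "compact Y"
    and \<rho>: "borel_prob_on X \<rho>" and \<mu>: "borel_prob_on Y \<mu>"
    and continuous_cost: "continuous_on (X \<times> Y) c"
begin

lemma space_\<rho>: "space \<rho> = X" and space_\<mu>: "space \<mu> = Y"
  using borel_prob_onD \<rho> \<mu> by blast+

sublocale \<rho>: prob_space \<rho> using borel_prob_onD \<rho> by blast
sublocale \<mu>: prob_space \<mu> using borel_prob_onD \<mu> by blast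

lemma X_nonempty: "X \<noteq> {}" and Y_nonempty: "Y \<noteq> {}"
  using \<rho>.not_empty \<mu>.not_empty space_\<rho> space_\<mu> by auto

lemma measurable_continuous_\<rho>: "continuous_on X f \<Longrightarrow> f \<in> borel_measurable \<rho>" for f :: "'a \<Rightarrow> real"
  using borel_measurable_continuous_on_restrict[of X f] \<rho>
  by (simp add: borel_prob_on_def cong: measurable_cong_sets)

lemma measurable_id_pair: "(\<lambda>z. z) \<in> \<rho> \<Otimes>\<^sub>M \<mu> \<rightarrow>\<^sub>M borel"
proof -
  have "(\<lambda>z. (fst z, snd z)) \<in> \<rho> \<Otimes>\<^sub>M \<mu> \<rightarrow>\<^sub>M borel \<Otimes>\<^sub>M borel"
    using measurable_compose[OF measurable_fst borel_prob_onD(3)[OF \<rho>]]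
      measurable_compose[OF measurable_snd borel_prob_onD(3)[OF \<mu>]]
    by (intro measurable_Pair)
  then show ?thesis by (simp add: borel_prod)
qed

lemma measurable_cost: "c \<in> borel_measurable (\<rho> \<Otimes>\<^sub>M \<mu>)"
proof -
  have "(\<lambda>z. z) \<in> \<rho> \<Otimes>\<^sub>M \<mu> \<rightarrow>\<^sub>M restrict_space borel (X \<times> Y)"
    by (intro measurable_restrict_space2 measurable_id_pair) (auto simp: space_pair_measure space_\<rho> space_\<mu>)
  from measurable_compose[OF this borel_measurable_continuous_on_restrict[OF continuous_cost]] show ?thesis .
qed

lemma cost_bounded: obtains C where "\<And>z. z \<in> X \<times> Y \<Longrightarrow> \<bar>c z\<bar> \<le> C"
proof -
  have "bounded (c ` (X \<times> Y))"
    using compact_X compact_Y continuous_cost by (intro compact_imp_bounded compact_continuous_image compact_Times)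
  then obtain C where "\<forall>z\<in>X \<times> Y. \<bar>c z\<bar> \<le> C" unfolding bounded_iff by auto
  then show thesis by (intro that[of C]) auto
qed

lemma cost_uniformly_continuous:
  assumes "\<epsilon> > 0"
  obtains \<delta> where "\<delta> > 0" and "\<And>z z'. z \<in> X \<times> Y \<Longrightarrow> z' \<in> X \<times> Y \<Longrightarrow> dist z z' < \<delta> \<Longrightarrow> \<bar>c z - c z'\<bar> < \<epsilon>"
proof -
  have "uniformly_continuous_on (X \<times> Y) c"
    using compact_X compact_Y continuous_cost by (intro compact_uniformly_continuous compact_Times)
  then obtain \<delta> where "\<delta> > 0" "\<forall>z\<in>X \<times> Y. \<forall>z'\<in>X \<times> Y. dist z' z < \<delta> \<longrightarrow> dist (c z') (c z) < \<epsilon>"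
    using assms unfolding uniformly_continuous_on_def by blast
  then show thesis by (intro that[of \<delta>]) (auto simp: dist_real_def)
qed

lemma couplingD:
  assumes "\<gamma> \<in> couplings \<rho> \<mu>"
  shows "sets \<gamma> = sets (\<rho> \<Otimes>\<^sub>M \<mu>)" and "space \<gamma> = X \<times> Y" and "prob_space \<gamma>"
    and "distr \<gamma> \<rho> fst = \<rho>" and "distr \<gamma> \<mu> snd = \<mu>" and "fst \<in> \<gamma> \<rightarrow>\<^sub>M \<rho>" and "snd \<in> \<gamma> \<rightarrow>\<^sub>M \<mu>"
    and "(\<lambda>z. z) \<in> \<gamma> \<rightarrow>\<^sub>M borel" and "c \<in> borel_measurable \<gamma>" and "integrable \<gamma> c"
proof -
  show s: "sets \<gamma> = sets (\<rho> \<Otimes>\<^sub>M \<mu>)" and 1: "distr \<gamma> \<rho> fst = \<rho>" and "distr \<gamma> \<mu> snd = \<mu>"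
    using assms by (auto simp: couplings_def)
  show sp: "space \<gamma> = X \<times> Y" using sets_eq_imp_space_eq[OF s] by (simp add: space_pair_measure space_\<rho> space_\<mu>)
  show f: "fst \<in> \<gamma> \<rightarrow>\<^sub>M \<rho>" and "snd \<in> \<gamma> \<rightarrow>\<^sub>M \<mu>" using s by (simp_all cong: measurable_cong_sets)
  show pr: "prob_space \<gamma>" using prob_space_distrD[OF f] 1 \<rho>.prob_space_axioms by simp
  then interpret prob_space \<gamma> .
  show "(\<lambda>z. z) \<in> \<gamma> \<rightarrow>\<^sub>M borel" using measurable_id_pair s by (simp cong: measurable_cong_sets)
  show m: "c \<in> borel_measurable \<gamma>" using measurable_cost s by (simp cong: measurable_cong_sets)
  obtain C where "\<And>z. z \<in> X \<times> Y \<Longrightarrow> \<bar>c z\<bar> \<le> C" using cost_bounded by blast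
  then show "integrable \<gamma> c" by (intro integrable_const_bound[where B = C] m AE_I2) (auto simp: sp)
qed

text \<open>
  The competitor \<open>\<gamma>'\<close> is the law of a uniformly chosen coordinate of an independent \<open>\<gamma>\<close>-sample of
  size \<open>N\<close>, whose first components are permuted whenever this lowers the cost.
\<close>

lemma optimal_coupling_cyclic_AE:
  assumes opt: "optimal_coupling c \<rho> \<mu> \<gamma>" and s: "bij_betw s {..<N::nat} {..<N}" and N: "N > 0"
  shows "AE z in Pi\<^sub>M {..<N} (\<lambda>_. \<gamma>). (\<Sum>i<N. c (z i)) \<le> (\<Sum>i<N. c (fst (z (s i)), snd (z i)))"
proof -
  have coup: "\<gamma> \<in> couplings \<rho> \<mu>" using opt by (simp add: optimal_coupling_def)
  note \<gamma> = couplingD[OF coup]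
  interpret \<gamma>: prob_space \<gamma> by (rule \<gamma>)
  define P where "P = Pi\<^sub>M {..<N} (\<lambda>_. \<gamma>)"
  interpret P: prob_space P unfolding P_def by (intro prob_space_PiM \<gamma>)
  define U where "U = uniform_count_measure {..<N}"
  interpret U: prob_space U unfolding U_def using N by (intro prob_space_uniform_count_measure) auto
  interpret PU: pair_prob_space P U ..
  have comp[measurable]: "(\<lambda>z. z i) \<in> P \<rightarrow>\<^sub>M \<gamma>" if "i < N" for i
    unfolding P_def using that by (intro measurable_component_singleton) simp
  have law: "distr P \<gamma> (\<lambda>z. z i) = \<gamma>" if "i < N" for i
    unfolding P_def using distr_PiM_component[of "{..<N}" "\<lambda>_. \<gamma>" i] \<gamma>(3) that by simp
  have sN: "s i < N" if "i < N" for i using s that by (auto simp: bij_betw_def)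
  have sums: "(\<Sum>i<N. f (s i)) = (\<Sum>i<N. f i)" for f :: "nat \<Rightarrow> real"
    using sum.reindex_bij_betw[OF s, of f] .
  define W where "W i z = (fst (z (s i)), snd (z i))" for i and z :: "nat \<Rightarrow> 'a \<times> 'b"
  have W: "W i \<in> P \<rightarrow>\<^sub>M \<gamma>" if "i < N" for i
  proof -
    have "W i \<in> P \<rightarrow>\<^sub>M \<rho> \<Otimes>\<^sub>M \<mu>"
      unfolding W_def using measurable_compose[OF comp[OF sN[OF that]] \<gamma>(6)] measurable_compose[OF comp[OF that] \<gamma>(7)]
      by (intro measurable_Pair)
    then show ?thesis using \<gamma>(1) by (simp cong: measurable_cong_sets)
  qed
  define better where "better z \<longleftrightarrow> (\<Sum>i<N. c (W i z)) < (\<Sum>i<N. c (z i))" for z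
  have better: "{z \<in> space P. better z} \<in> sets P"
    unfolding better_def
    using measurable_compose[OF comp \<gamma>(9)] measurable_compose[OF W \<gamma>(9)]
    by (intro borel_measurable_less borel_measurable_sum) auto
  \<comment> \<open>The decision is made for the sample as a whole: the first marginal survives
    because either all first components are permuted or none.\<close>
  define T where "T i z = (if better z then W i z else z i)" for i z
  have T: "T i \<in> P \<rightarrow>\<^sub>M \<gamma>" if "i < N" for i
    unfolding T_def using W comp that better by (intro measurable_If) auto
  have TQ: "(\<lambda>(z, i). T i z) \<in> P \<Otimes>\<^sub>M U \<rightarrow>\<^sub>M \<gamma>"
  proof -
    have "(\<lambda>q. T (snd q) (fst q)) \<in> P \<Otimes>\<^sub>M U \<rightarrow>\<^sub>M \<gamma>"
    proof (rule measurable_compose_countable'[where I = "{..<N}"])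
      show "(\<lambda>q. T i (fst q)) \<in> P \<Otimes>\<^sub>M U \<rightarrow>\<^sub>M \<gamma>" if "i \<in> {..<N}" for i
        using T that by (intro measurable_compose[OF measurable_fst]) auto
      have "sets U = sets (count_space {..<N})" by (simp add: U_def uniform_count_measure_def sets_point_measure)
      from measurable_cong_sets[OF refl this, of "P \<Otimes>\<^sub>M U"]
      show "snd \<in> P \<Otimes>\<^sub>M U \<rightarrow>\<^sub>M count_space {..<N}" using measurable_snd[of P U] by blast
    qed auto
    then show ?thesis by (simp add: case_prod_beta')
  qed
  define \<gamma>' where "\<gamma>' = distr (P \<Otimes>\<^sub>M U) \<gamma> (\<lambda>(z, i). T i z)"
  interpret \<gamma>': prob_space \<gamma>' unfolding \<gamma>'_def using TQ by (intro PU.prob_space_distr)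
  have int_\<gamma>': "(LINT q|\<gamma>'. f q) = (LINT z|P. (\<Sum>i<N. f (T i z)) / N)"
    if f: "f \<in> borel_measurable \<gamma>" and b: "\<And>q. q \<in> space \<gamma> \<Longrightarrow> \<bar>f q\<bar> \<le> B" for f :: "'a \<times> 'b \<Rightarrow> real" and B
  proof -
    have "(LINT q|\<gamma>'. f q) = (LINT x|(P \<Otimes>\<^sub>M U). f (case x of (z, i) \<Rightarrow> T i z))"
      unfolding \<gamma>'_def by (rule integral_distr[OF TQ f])
    also have "\<dots> = (LINT z|P. (LINT i|U. f (T i z)))"
    proof -
      have "integrable (P \<Otimes>\<^sub>M U) (\<lambda>x. f (case x of (z, i) \<Rightarrow> T i z))"
        using measurable_space[OF TQ] b
        by (intro PU.integrable_const_bound[where B = B] AE_I2 measurable_compose[OF TQ f]) auto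
      from PU.integral_fst'[OF this] show ?thesis by simp
    qed
    also have "\<dots> = (LINT z|P. (\<Sum>i<N. f (T i z)) / N)"
      unfolding U_def by (simp add: integral_uniform_count_measure)
    finally show ?thesis .
  qed
  have integrable_coord: "integrable P (\<lambda>z. f (z i))"
    and int_coord: "(LINT z|P. f (z i)) = (LINT q|\<gamma>. f q)"
    if "i < N" and f: "f \<in> borel_measurable \<gamma>" and b: "\<And>q. q \<in> space \<gamma> \<Longrightarrow> \<bar>f q\<bar> \<le> B" for f :: "'a \<times> 'b \<Rightarrow> real" and i B
  proof -
    show "integrable P (\<lambda>z. f (z i))"
      using measurable_space[OF comp[OF that(1)]] b
      by (intro P.integrable_const_bound[where B = B] AE_I2 measurable_compose[OF comp f] that(1)) auto
    show "(LINT z|P. f (z i)) = (LINT q|\<gamma>. f q)"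
      using integral_distr[OF comp[OF that(1)] f] by (simp add: law[OF that(1)])
  qed
  have int_\<gamma>: "(LINT z|P. (\<Sum>i<N. f (z i)) / N) = (LINT q|\<gamma>. f q)"
    if f: "f \<in> borel_measurable \<gamma>" and b: "\<And>q. q \<in> space \<gamma> \<Longrightarrow> \<bar>f q\<bar> \<le> B" for f :: "'a \<times> 'b \<Rightarrow> real" and B
    using integrable_coord[OF _ f b] int_coord[OF _ f b] N by (simp add: Bochner_Integration.integral_sum)
  \<comment> \<open>For \<open>g = fst\<close> the invariance \<open>inv\<close> holds because a
    permutation does not change a sum, for \<open>g = snd\<close> because second components are
    never moved. Taking \<open>f\<close> to be an indicator gives equality of measures.\<close>
  have marginal: "distr \<gamma>' M g = M"
    if g: "g \<in> \<gamma> \<rightarrow>\<^sub>M M" and d: "distr \<gamma> M g = M"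
      and inv: "\<And>f z. (\<Sum>i<N. f (g (T i z))) = (\<Sum>i<N. f (g (z i)) :: real)" for M and g :: "'a \<times> 'b \<Rightarrow> 'm"
  proof (rule measure_eqI)
    show "sets (distr \<gamma>' M g) = sets M" by simp
    fix A assume "A \<in> sets (distr \<gamma>' M g)"
    then have A: "A \<in> sets M" by simp
    have g': "g \<in> \<gamma>' \<rightarrow>\<^sub>M M" using g by (simp add: \<gamma>'_def)
    define f :: "'m \<Rightarrow> real" where "f = indicator A"
    have fm: "f \<in> borel_measurable M" using A by (simp add: f_def)
    have fg: "(\<lambda>q. f (g q)) \<in> borel_measurable \<gamma>" by (rule measurable_compose[OF g fm])
    have b: "\<bar>f (g q)\<bar> \<le> 1" for q by (simp add: f_def indicator_def)
    have "measure (distr \<gamma>' M g) A = (LINT x|distr \<gamma>' M g. f x)" using A sets.sets_into_space[OF A] by (simp add: f_def Int_absorb2)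
    also have "\<dots> = (LINT q|\<gamma>'. f (g q))" by (rule integral_distr[OF g' fm])
    also have "\<dots> = (LINT q|\<gamma>. f (g q))"
      unfolding int_\<gamma>'[OF fg b] inv[of f] by (rule int_\<gamma>[OF fg b])
    also have "\<dots> = (LINT x|distr \<gamma> M g. f x)" by (rule integral_distr[OF g fm, symmetric])
    also have "\<dots> = measure M A" unfolding d using A sets.sets_into_space[OF A] by (simp add: f_def Int_absorb2)
    finally have e: "measure (distr \<gamma>' M g) A = measure M A" .
    interpret D': prob_space "distr \<gamma>' M g" by (rule \<gamma>'.prob_space_distr[OF g'])
    interpret D: prob_space "M" using \<gamma>.prob_space_distr[OF g] by (simp add: d)
    show "emeasure (distr \<gamma>' M g) A = emeasure M A"
      using e by (simp add: D'.emeasure_eq_measure D.emeasure_eq_measure)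
  qed
  have "\<gamma>' \<in> couplings \<rho> \<mu>"
  proof -
    have "distr \<gamma>' \<rho> fst = \<rho>"
    proof (rule marginal[OF \<gamma>(6) \<gamma>(4)])
      show "(\<Sum>i<N. f (fst (T i z))) = (\<Sum>i<N. f (fst (z i)))" for f :: "'a \<Rightarrow> real" and z
        using sums[of "\<lambda>i. f (fst (z i))"] by (cases "better z") (simp_all add: T_def W_def)
    qed
    moreover have "distr \<gamma>' \<mu> snd = \<mu>"
    proof (rule marginal[OF \<gamma>(7) \<gamma>(5)])
      show "(\<Sum>i<N. f (snd (T i z))) = (\<Sum>i<N. f (snd (z i)))" for f :: "'b \<Rightarrow> real" and z
        by (cases "better z") (simp_all add: T_def W_def)
    qed
    ultimately show ?thesis using \<gamma>(1) by (simp add: couplings_def \<gamma>'_def)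
  qed
  then have le: "(LINT q|\<gamma>. c q) \<le> (LINT q|\<gamma>'. c q)"
    using opt by (simp add: optimal_coupling_def)
  obtain C where C: "\<And>q. q \<in> space \<gamma> \<Longrightarrow> \<bar>c q\<bar> \<le> C" using cost_bounded \<gamma>(2) by metis
  \<comment> \<open>\<open>D\<close> is the average saving of the sample. It is nonnegative by
    construction, and its mean is at most 0 by optimality of \<open>\<gamma>\<close>; so a strict
    saving has probability zero.\<close>
  define D where "D z = (\<Sum>i<N. c (z i)) / N - (\<Sum>i<N. c (T i z)) / N" for z
  have iT: "integrable P (\<lambda>z. c (T i z))" if "i < N" for i
    using measurable_space[OF T[OF that]] C
    by (intro P.integrable_const_bound[where B = C] AE_I2 measurable_compose[OF T \<gamma>(9)] that) auto
  have iD: "integrable P (\<lambda>z. (\<Sum>i<N. c (z i)) / N)" "integrable P (\<lambda>z. (\<Sum>i<N. c (T i z)) / N)"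
    using integrable_coord[OF _ \<gamma>(9) C] iT by (auto intro!: integrable_divide Bochner_Integration.integrable_sum)
  have D0: "D z \<ge> 0" for z
    by (cases "better z") (auto simp: D_def T_def better_def intro!: divide_right_mono)
  have "(LINT z|P. D z) \<le> 0"
    unfolding D_def using le iD int_\<gamma>'[OF \<gamma>(9) C] int_\<gamma>[OF \<gamma>(9) C] by simp
  moreover have "(LINT z|P. D z) \<ge> 0" using D0 by (intro integral_nonneg_AE AE_I2)
  ultimately have "(LINT z|P. D z) = 0" by simp
  then have "AE z in P. D z = 0"
    using integral_nonneg_eq_0_iff_AE[of P D] D0 iD unfolding D_def by auto
  then show ?thesis unfolding P_def[symmetric]
  proof (rule AE_mp, intro AE_I2 impI)
    fix z assume "D z = 0"
    then have "\<not> better z" using N by (cases "better z") (auto simp: D_def T_def better_def)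
    then show "(\<Sum>i<N. c (z i)) \<le> (\<Sum>i<N. c (fst (z (s i)), snd (z i)))"
      by (simp add: better_def W_def)
  qed
qed

text \<open>A box of small balls around points of the support has positive product measure, so it
  contains a sample that obeys the almost sure inequality. Uniform continuity of the cost carries
  the inequality over to the centres.\<close>

lemma Supp_optimal_cyclic:
  assumes opt: "optimal_coupling c \<rho> \<mu> \<gamma>" and s: "bij_betw s {..<N::nat} {..<N}"
    and z: "\<And>i. i < N \<Longrightarrow> z i \<in> Supp \<gamma>"
  shows "(\<Sum>i<N. c (z i)) \<le> (\<Sum>i<N. c (fst (z (s i)), snd (z i)))"
proof (cases "N = 0")
  case False
  have coup: "\<gamma> \<in> couplings \<rho> \<mu>" using opt by (simp add: optimal_coupling_def)
  note \<gamma> = couplingD[OF coup]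
  interpret product_prob_space "\<lambda>_. \<gamma>" "{..<N}" using \<gamma>(3) by (simp add: product_prob_spaceI)
  have sN: "s i < N" if "i < N" for i using s that by (auto simp: bij_betw_def)
  have zXY: "z i \<in> X \<times> Y" if "i < N" for i using z[OF that] by (simp add: Supp_def \<gamma>(2))
  show ?thesis
  proof (rule field_le_epsilon)
    fix e :: real assume e: "e > 0"
    \<comment> \<open>Each of the \<open>N\<close> terms is shifted by at most
      \<open>\<epsilon>\<close>, once on either side of the inequality.\<close>
    define \<epsilon> where "\<epsilon> = e / (2 * N)"
    have \<epsilon>: "\<epsilon> > 0" using e False by (simp add: \<epsilon>_def)
    obtain \<delta> where \<delta>: "\<delta> > 0" and uc: "\<And>z z'. z \<in> X \<times> Y \<Longrightarrow> z' \<in> X \<times> Y \<Longrightarrow> dist z z' < \<delta> \<Longrightarrow> \<bar>c z - c z'\<bar> < \<epsilon>"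
      using cost_uniformly_continuous[OF \<epsilon>] by blast
    define V where "V i = ball (z i) (\<delta> / 2) \<inter> space \<gamma>" for i
    have Vs: "V i \<in> sets \<gamma>" for i
      using measurable_sets[OF \<gamma>(8), of "ball (z i) (\<delta> / 2)"] by (simp add: V_def)
    have Vp: "emeasure \<gamma> (V i) > 0" if "i < N" for i
      using z[OF that] \<delta> unfolding Supp_def V_def by (auto simp del: ball_eq_empty)
    have "emeasure (Pi\<^sub>M {..<N} (\<lambda>_. \<gamma>)) (Pi\<^sub>E {..<N} V) = (\<Prod>i<N. emeasure \<gamma> (V i))"
      using Vs by (intro emeasure_PiM) auto
    then have pos: "emeasure (Pi\<^sub>M {..<N} (\<lambda>_. \<gamma>)) (Pi\<^sub>E {..<N} V) \<noteq> 0"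
      using Vp by (fastforce dest: less_imp_neq)
    have "\<exists>q\<in>Pi\<^sub>E {..<N} V. (\<Sum>i<N. c (q i)) \<le> (\<Sum>i<N. c (fst (q (s i)), snd (q i)))"
    proof (rule ccontr)
      assume "\<not> ?thesis"
      then have "AE q in Pi\<^sub>M {..<N} (\<lambda>_. \<gamma>). q \<notin> Pi\<^sub>E {..<N} V"
        using optimal_coupling_cyclic_AE[OF opt s] False by (auto elim!: AE_mp)
      moreover have "Pi\<^sub>E {..<N} V \<in> sets (Pi\<^sub>M {..<N} (\<lambda>_. \<gamma>))" using Vs by (intro sets_PiM_I_finite) auto
      ultimately show False using pos AE_iff_measurable[of "Pi\<^sub>E {..<N} V" "Pi\<^sub>M {..<N} (\<lambda>_. \<gamma>)" "\<lambda>q. q \<notin> Pi\<^sub>E {..<N} V"]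
        by (auto dest: sets.sets_into_space)
    qed
    then obtain q where q: "q \<in> Pi\<^sub>E {..<N} V" and qle: "(\<Sum>i<N. c (q i)) \<le> (\<Sum>i<N. c (fst (q (s i)), snd (q i)))"
      by blast
    have qi: "q i \<in> X \<times> Y" "dist (z i) (q i) < \<delta> / 2" if "i < N" for i
      using q that \<gamma>(2) by (auto simp: PiE_iff V_def)
    have a: "c (z i) \<le> c (q i) + \<epsilon>" if "i < N" for i
      using uc[OF zXY qi(1), OF that that] qi(2)[OF that] \<delta> by auto
    have b: "c (fst (q (s i)), snd (q i)) \<le> c (fst (z (s i)), snd (z i)) + \<epsilon>" if "i < N" for i
    proof -
      have "dist (fst (z (s i)), snd (z i)) (fst (q (s i)), snd (q i)) \<le> dist (fst (z (s i))) (fst (q (s i))) + dist (snd (z i)) (snd (q i))"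
        unfolding dist_Pair_Pair by (rule sqrt_sum_squares_le_sum) auto
      also have "\<dots> < \<delta>"
        using dist_fst_le[of "z (s i)" "q (s i)"] dist_snd_le[of "z i" "q i"] qi(2)[OF that] qi(2)[OF sN[OF that]] by simp
      finally have "\<bar>c (fst (z (s i)), snd (z i)) - c (fst (q (s i)), snd (q i))\<bar> < \<epsilon>"
        using zXY[OF that] zXY[OF sN[OF that]] qi(1)[OF that] qi(1)[OF sN[OF that]] by (intro uc) (auto simp: mem_Times_iff)
      then show ?thesis by linarith
    qed
    have "(\<Sum>i<N. c (z i)) \<le> (\<Sum>i<N. c (q i) + \<epsilon>)" using a by (intro sum_mono) auto
    also have "\<dots> = (\<Sum>i<N. c (q i)) + N * \<epsilon>" by (simp add: sum.distrib)
    also have "(\<Sum>i<N. c (q i)) \<le> (\<Sum>i<N. c (fst (z (s i)), snd (z i)) + \<epsilon>)"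
      using b by (intro order_trans[OF qle] sum_mono) auto
    also have "\<dots> = (\<Sum>i<N. c (fst (z (s i)), snd (z i))) + N * \<epsilon>" by (simp add: sum.distrib)
    also have "(\<Sum>i<N. c (fst (z (s i)), snd (z i))) + N * \<epsilon> + N * \<epsilon> = (\<Sum>i<N. c (fst (z (s i)), snd (z i))) + e"
      using False by (simp add: \<epsilon>_def)
    finally show "(\<Sum>i<N. c (z i)) \<le> (\<Sum>i<N. c (fst (z (s i)), snd (z i))) + e" by simp
  qed
qed simp

end

section \<open>Duality\<close>

text \<open>A common modulus of continuity passes to the infimum. Boundedness below matters because
  \<open>INF\<close> is an infimum in the reals, with no useful value for unbounded
  families.\<close>

lemma continuous_on_INF:
  fixes F :: "'i \<Rightarrow> 'a::metric_space \<Rightarrow> real"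
  assumes I: "I \<noteq> {}" and bdd: "\<And>x. x \<in> X \<Longrightarrow> bdd_below ((\<lambda>i. F i x) ` I)"
    and equi: "\<And>\<epsilon>. \<epsilon> > 0 \<Longrightarrow> \<exists>\<delta>>0. \<forall>x\<in>X. \<forall>x'\<in>X. dist x x' < \<delta> \<longrightarrow> (\<forall>i\<in>I. F i x \<le> F i x' + \<epsilon>)"
  shows "continuous_on X (\<lambda>x. INF i\<in>I. F i x)"
  unfolding continuous_on_iff
proof (intro ballI allI impI)
  fix x and e :: real assume x: "x \<in> X" and "e > 0"
  then obtain \<delta> where \<delta>: "\<delta> > 0" and F: "\<And>x x' i. x \<in> X \<Longrightarrow> x' \<in> X \<Longrightarrow> dist x x' < \<delta> \<Longrightarrow> i \<in> I \<Longrightarrow> F i x \<le> F i x' + e / 2"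
    using equi[of "e / 2"] by (auto simp: Ball_def)
  have "(INF i\<in>I. F i u) - e / 2 \<le> (INF i\<in>I. F i u')" if "u \<in> X" "u' \<in> X" "dist u u' < \<delta>" for u u'
  proof (rule cINF_greatest[OF I])
    fix i assume i: "i \<in> I"
    have "(INF i\<in>I. F i u) \<le> F i u" by (rule cINF_lower[OF bdd[OF that(1)] i])
    then show "(INF i\<in>I. F i u) - e / 2 \<le> F i u'" using F[OF that i] by linarith
  qed
  from this[OF x] this[OF _ x] show "\<exists>d>0. \<forall>x'\<in>X. dist x' x < d \<longrightarrow> dist (INF i\<in>I. F i x') (INF i\<in>I. F i x) < e"
    using \<delta> \<open>e > 0\<close> by (intro exI[of _ \<delta>]) (force simp: dist_real_def dist_commute abs_less_iff)
qed

lemma dual_optimal_swap: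
  assumes "dual_optimal c \<rho> \<mu> \<phi> \<psi>"
  shows "dual_optimal (\<lambda>(y, x). c (x, y)) \<mu> \<rho> \<psi> \<phi>"
proof -
  have "dual_feasible (\<lambda>(y, x). c (x, y)) \<mu> \<rho> \<psi> \<phi> \<longleftrightarrow> dual_feasible c \<rho> \<mu> \<phi> \<psi>" for \<phi> \<psi>
    by (auto simp: dual_feasible_def add.commute)
  then show ?thesis using assms unfolding dual_optimal_def by (simp add: add.commute)
qed

context transport_problem
begin

text \<open>Exchanging the two factors turns every result on \<open>\<rho>\<close> and
  \<open>\<phi>\<close> into one on \<open>\<mu>\<close> and \<open>\<psi>\<close>.\<close>

lemma swap: "transport_problem Y X \<mu> \<rho> (\<lambda>(y, x). c (x, y))"
proof
  have "continuous_on (Y \<times> X) (\<lambda>q. c (snd q, fst q))"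
    by (rule continuous_on_compose2[OF continuous_cost]) (auto intro!: continuous_intros)
  then show "continuous_on (Y \<times> X) (\<lambda>(y, x). c (x, y))" by (simp add: case_prod_beta')
qed (fact compact_X compact_Y \<rho> \<mu>)+

lemma integrable_continuous_\<rho>:
  fixes f :: "'a \<Rightarrow> real"
  assumes "continuous_on X f"
  shows "integrable \<rho> f"
proof -
  obtain B where "\<forall>x\<in>X. \<bar>f x\<bar> \<le> B"
    using compact_imp_bounded[OF compact_continuous_image[OF assms compact_X]] unfolding bounded_iff by auto
  then show ?thesis
    by (intro \<rho>.integrable_const_bound[where B = B] AE_I2 measurable_continuous_\<rho> assms) (auto simp: space_\<rho>)
qed

lemma integrable_continuous_\<mu>: "continuous_on Y f \<Longrightarrow> integrable \<mu> f" for f :: "'b \<Rightarrow> real"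
  by (rule transport_problem.integrable_continuous_\<rho>[OF swap])

lemma equicontinuous_cost:
  assumes "\<epsilon> > 0"
  shows "\<exists>\<delta>>0. \<forall>x\<in>X. \<forall>x'\<in>X. dist x x' < \<delta> \<longrightarrow> (\<forall>y\<in>Y. c (x, y) \<le> c (x', y) + \<epsilon>)"
proof -
  obtain \<delta> where "\<delta> > 0" and \<delta>: "\<And>z z'. z \<in> X \<times> Y \<Longrightarrow> z' \<in> X \<times> Y \<Longrightarrow> dist z z' < \<delta> \<Longrightarrow> \<bar>c z - c z'\<bar> < \<epsilon>"
    using cost_uniformly_continuous[OF assms] by blast
  have "c (x, y) \<le> c (x', y) + \<epsilon>" if "x \<in> X" "x' \<in> X" "dist x x' < \<delta>" "y \<in> Y" for x x' y
    using \<delta>[of "(x, y)" "(x', y)"] that by (simp add: dist_Pair_Pair)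
  then show ?thesis using \<open>\<delta> > 0\<close> by blast
qed

text \<open>However irregular \<open>\<psi>\<close> is, subtracting \<open>\<psi> y\<close> does not
  affect the modulus of continuity in \<open>x\<close>, which is that of the cost. The given
  \<open>\<phi>\<close> keeps the infimum finite and lies below it.\<close>

lemma c_transform:
  assumes feas: "\<And>x y. x \<in> X \<Longrightarrow> y \<in> Y \<Longrightarrow> \<phi> x + \<psi> y \<le> c (x, y)"
  defines "\<phi>' \<equiv> \<lambda>x. INF y\<in>Y. c (x, y) - \<psi> y"
  shows "continuous_on X \<phi>'" and "\<And>x y. x \<in> X \<Longrightarrow> y \<in> Y \<Longrightarrow> \<phi>' x + \<psi> y \<le> c (x, y)"
    and "\<And>x. x \<in> X \<Longrightarrow> \<phi> x \<le> \<phi>' x"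
proof -
  have bdd: "bdd_below ((\<lambda>y. c (x, y) - \<psi> y) ` Y)" if "x \<in> X" for x
    using feas[OF that] by (intro bdd_belowI2[where m = "\<phi> x"]) (simp add: le_diff_eq)
  show "continuous_on X \<phi>'"
    unfolding \<phi>'_def
  proof (rule continuous_on_INF[OF Y_nonempty bdd])
    fix \<epsilon> :: real assume "\<epsilon> > 0"
    from equicontinuous_cost[OF this] show "\<exists>\<delta>>0. \<forall>x\<in>X. \<forall>x'\<in>X. dist x x' < \<delta> \<longrightarrow> (\<forall>y\<in>Y. c (x, y) - \<psi> y \<le> c (x', y) - \<psi> y + \<epsilon>)"
      by (simp add: algebra_simps)
  qed
  show "\<phi>' x + \<psi> y \<le> c (x, y)" if "x \<in> X" "y \<in> Y" for x y
    using cINF_lower[OF bdd[OF that(1)] that(2)] unfolding \<phi>'_def by (simp add: le_diff_eq)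
  show "\<phi> x \<le> \<phi>' x" if "x \<in> X" for x
    unfolding \<phi>'_def using feas[OF that] by (intro cINF_greatest Y_nonempty) (simp add: le_diff_eq)
qed

lemma integral_coupling:
  assumes coup: "\<gamma> \<in> couplings \<rho> \<mu>" and int: "integrable \<rho> \<phi>" "integrable \<mu> (\<psi> :: _ \<Rightarrow> real)"
  shows "integrable \<gamma> (\<lambda>z. \<phi> (fst z) + \<psi> (snd z))"
    and "(LINT z|\<gamma>. \<phi> (fst z) + \<psi> (snd z)) = (LINT x|\<rho>. \<phi> x) + (LINT y|\<mu>. \<psi> y)"
proof -
  note \<gamma> = couplingD[OF coup]
  have i: "integrable \<gamma> (\<lambda>z. \<phi> (fst z))" "integrable \<gamma> (\<lambda>z. \<psi> (snd z))"
    using integrable_distr[OF \<gamma>(6), of \<phi>] integrable_distr[OF \<gamma>(7), of \<psi>] int \<gamma>(4,5) by simp_all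
  then show "integrable \<gamma> (\<lambda>z. \<phi> (fst z) + \<psi> (snd z))" by simp
  have "(LINT x|\<rho>. \<phi> x) = (LINT z|\<gamma>. \<phi> (fst z))" "(LINT y|\<mu>. \<psi> y) = (LINT z|\<gamma>. \<psi> (snd z))"
    using integral_distr[OF \<gamma>(6), of \<phi>] integral_distr[OF \<gamma>(7), of \<psi>] int \<gamma>(4,5) by auto
  then show "(LINT z|\<gamma>. \<phi> (fst z) + \<psi> (snd z)) = (LINT x|\<rho>. \<phi> x) + (LINT y|\<mu>. \<psi> y)"
    using i by simp
qed

text \<open>Rockafellar's construction: \<open>\<phi>\<close> is the infimum of the cost increments along chains in the support.\<close>

lemma strong_duality:
  assumes opt: "optimal_coupling c \<rho> \<mu> \<gamma>"
  obtains \<phi> \<psi> where "dual_feasible c \<rho> \<mu> \<phi> \<psi>" and "(LINT z|\<gamma>. c z) \<le> (LINT x|\<rho>. \<phi> x) + (LINT y|\<mu>. \<psi> y)"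
proof -
  have coup: "\<gamma> \<in> couplings \<rho> \<mu>" using opt by (simp add: optimal_coupling_def)
  note \<gamma> = couplingD[OF coup]
  interpret \<gamma>: prob_space \<gamma> by (rule \<gamma>)
  define S where "S = Supp \<gamma>"
  have AE_S: "AE z in \<gamma>. z \<in> S" unfolding S_def by (rule AE_in_Supp[OF \<gamma>(8)])
  have S: "S \<subseteq> X \<times> Y" using \<gamma>(2) by (auto simp: S_def Supp_def)
  have "S \<noteq> {}" using AE_S \<gamma>.AE_False by auto
  then obtain z0 where z0: "z0 \<in> S" by blast
  have SX: "fst z \<in> X" and SY: "snd z \<in> Y" if "z \<in> S" for z using S that by (auto simp: mem_Times_iff)
  obtain C where C: "\<And>z. z \<in> X \<times> Y \<Longrightarrow> \<bar>c z\<bar> \<le> C" using cost_bounded by blast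
  define I where "I = {(n :: nat, q :: nat \<Rightarrow> 'a \<times> 'b). q 0 = z0 \<and> range q \<subseteq> S}"
  \<comment> \<open>Writing \<open>q j = (x j, y j)\<close>, the value \<open>F (n, q) u\<close> is
    \<open>c (u, y n) - c (x n, y n)\<close> plus the sum of
    \<open>c (x (Suc j), y j) - c (x j, y j)\<close> over \<open>j < n\<close>. Only
    \<open>q 0\<close> to \<open>q n\<close> enter; the chain starts at \<open>z0\<close> and ends
    at \<open>u\<close>.\<close>
  define b where "b i = (case i of (n, q) \<Rightarrow> (\<Sum>j<n. c (fst (q (Suc j)), snd (q j))) - (\<Sum>j<Suc n. c (q j)))"
    for i :: "nat \<times> (nat \<Rightarrow> 'a \<times> 'b)"
  define F where "F i x = c (x, snd (snd i (fst i))) + b i" for i :: "nat \<times> (nat \<Rightarrow> 'a \<times> 'b)" and x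
  have ISY: "snd (snd i (fst i)) \<in> Y" if "i \<in> I" for i
    using that by (intro SY) (auto simp: I_def image_subset_iff)
  have I: "I \<noteq> {}" using z0 by (auto simp: I_def intro!: exI[of _ "\<lambda>_. z0"])
  have base: "F i (fst z0) \<ge> 0" if i: "i \<in> I" for i
  proof -
    obtain n q where nq: "i = (n, q)" "q 0 = z0" "\<And>j. q j \<in> S" using i by (auto simp: I_def image_subset_iff)
    \<comment> \<open>Closing the chain at \<open>z0\<close> is a cyclic shift of
      \<open>n + 1\<close> indices, so cyclical monotonicity says exactly that
      \<open>F i (fst z0)\<close> is nonnegative.\<close>
    define s where "s j = (if j < n then Suc j else 0)" for j
    have "bij_betw s {..<Suc n} {..<Suc n}"
      by (rule bij_betw_byWitness[where f' = "\<lambda>j. if j = 0 then n else j - 1"]) (auto simp: s_def)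
    from Supp_optimal_cyclic[OF opt this, of q] nq
    have "(\<Sum>j<Suc n. c (q j)) \<le> (\<Sum>j<Suc n. c (fst (q (s j)), snd (q j)))" by (simp add: S_def)
    also have "\<dots> = (\<Sum>j<n. c (fst (q (Suc j)), snd (q j))) + c (fst z0, snd (q n))"
      using nq(2) by (simp add: s_def)
    finally show ?thesis by (simp add: F_def b_def nq(1))
  qed
  \<comment> \<open>Replacing \<open>x\<close> by \<open>fst z0\<close>, where \<open>F i\<close> is
    nonnegative, changes the value by at most \<open>2 * C\<close>.\<close>
  have bdd: "bdd_below ((\<lambda>i. F i x) ` I)" if x: "x \<in> X" for x
  proof (rule bdd_belowI2)
    fix i assume i: "i \<in> I"
    have "\<bar>c (x, snd (snd i (fst i)))\<bar> \<le> C" "\<bar>c (fst z0, snd (snd i (fst i)))\<bar> \<le> C"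
      using x SX[OF z0] ISY[OF i] by (auto intro!: C)
    then show "- 2 * C \<le> F i x" using base[OF i] by (simp add: F_def)
  qed
  define \<phi> where "\<phi> x = (INF i\<in>I. F i x)" for x
  have cont: "continuous_on X \<phi>"
    unfolding \<phi>_def
  proof (rule continuous_on_INF[OF I bdd])
    fix \<epsilon> :: real assume "\<epsilon> > 0"
    from equicontinuous_cost[OF this] show "\<exists>\<delta>>0. \<forall>x\<in>X. \<forall>x'\<in>X. dist x x' < \<delta> \<longrightarrow> (\<forall>i\<in>I. F i x \<le> F i x' + \<epsilon>)"
      using ISY unfolding F_def by (fastforce simp: algebra_simps)
  qed
  \<comment> \<open>A chain ending at \<open>fst z\<close> is prolonged by \<open>z\<close> and then
    evaluated at \<open>x\<close>. Rearranged,
    \<open>c z - \<phi> (fst z) \<le> c (x, snd z) - \<phi> x\<close>: the infimum defining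
    \<open>\<psi> (snd z)\<close> is attained at \<open>fst z\<close>.\<close>
  have step: "\<phi> x + c z - c (x, snd z) \<le> \<phi> (fst z)" if z: "z \<in> S" and x: "x \<in> X" for z x
    unfolding \<phi>_def[of "fst z"]
  proof (rule cINF_greatest[OF I])
    fix i assume i: "i \<in> I"
    then obtain n q where nq: "i = (n, q)" "q 0 = z0" "\<And>j. q j \<in> S" by (auto simp: I_def image_subset_iff)
    define q' where "q' = q(Suc n := z)"
    have I': "(Suc n, q') \<in> I" using nq z by (auto simp: I_def q'_def)
    have eq: "(\<Sum>j<n. c (fst (q' (Suc j)), snd (q' j))) = (\<Sum>j<n. c (fst (q (Suc j)), snd (q j)))"
      "(\<Sum>j<Suc n. c (q' j)) = (\<Sum>j<Suc n. c (q j))"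
      unfolding q'_def by (rule sum.cong; simp)+
    have q'n: "q' n = q n" "q' (Suc n) = z" by (simp_all add: q'_def)
    have "F (Suc n, q') x = c (x, snd z) + (\<Sum>j<n. c (fst (q' (Suc j)), snd (q' j))) + c (fst (q' (Suc n)), snd (q' n))
       - ((\<Sum>j<Suc n. c (q' j)) + c (q' (Suc n)))"
      by (simp add: F_def b_def q'n)
    also have "\<dots> = F i (fst z) + c (x, snd z) - c z"
      unfolding eq q'n by (simp add: F_def b_def nq(1))
    finally have "F (Suc n, q') x = F i (fst z) + c (x, snd z) - c z" .
    moreover have "\<phi> x \<le> F (Suc n, q') x" unfolding \<phi>_def by (rule cINF_lower[OF bdd[OF x] I'])
    ultimately show "\<phi> x + c z - c (x, snd z) \<le> F i (fst z)" by linarith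
  qed
  obtain B where B: "\<And>x. x \<in> X \<Longrightarrow> \<bar>\<phi> x\<bar> \<le> B"
    using compact_imp_bounded[OF compact_continuous_image[OF cont compact_X]] unfolding bounded_iff by auto
  \<comment> \<open>The constant \<open>- C - B\<close> is a crude feasible partner of
    \<open>\<phi>\<close>; it keeps the infimum defining \<open>\<psi>\<close> bounded
    below.\<close>
  have feas0: "(- C - B) + \<phi> x \<le> (\<lambda>(y, x). c (x, y)) (y, x)" if "y \<in> Y" "x \<in> X" for x y
    using C[of "(x, y)"] B[of x] that by (simp add: abs_le_iff)
  define \<psi> where "\<psi> y = (INF x\<in>X. c (x, y) - \<phi> x)" for y
  note ct = transport_problem.c_transform[OF swap feas0, simplified, folded \<psi>_def]
  have feas: "dual_feasible c \<rho> \<mu> \<phi> \<psi>"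
    unfolding dual_feasible_def space_\<rho> space_\<mu>
    using integrable_continuous_\<rho>[OF cont] integrable_continuous_\<mu>[of \<psi>] ct(1,2) by (auto simp: add.commute)
  moreover have "(LINT z|\<gamma>. c z) \<le> (LINT z|\<gamma>. \<phi> (fst z) + \<psi> (snd z))"
  proof (rule integral_mono_AE[OF \<gamma>(10)])
    show "integrable \<gamma> (\<lambda>z. \<phi> (fst z) + \<psi> (snd z))"
      using feas by (intro integral_coupling coup) (auto simp: dual_feasible_def)
    show "AE z in \<gamma>. c z \<le> \<phi> (fst z) + \<psi> (snd z)"
      using AE_S
    proof (rule AE_mp, intro AE_I2 impI)
      fix z assume z: "z \<in> S"
      have "c z - \<phi> (fst z) \<le> \<psi> (snd z)"
        unfolding \<psi>_def using step[OF z] by (intro cINF_greatest X_nonempty) (simp add: algebra_simps)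
      then show "c z \<le> \<phi> (fst z) + \<psi> (snd z)" by simp
    qed
  qed
  ultimately show thesis
    using integral_coupling(2)[OF coup, of \<phi> \<psi>] by (intro that) (auto simp: dual_feasible_def)
qed

text \<open>Strong duality gives the nonnegative gap between cost and potentials integral zero under
  \<open>\<gamma>\<close>. Coupling and potentials are arbitrary optimisers, so two dual solutions
  share contact points and every edge of the graph may use its own coupling.\<close>

lemma complementary_slackness:
  assumes opt: "optimal_coupling c \<rho> \<mu> \<gamma>" and dual: "dual_optimal c \<rho> \<mu> \<phi> \<psi>"
  shows "AE z in \<gamma>. \<phi> (fst z) + \<psi> (snd z) = c z"
proof -
  have coup: "\<gamma> \<in> couplings \<rho> \<mu>" using opt by (simp add: optimal_coupling_def)
  note \<gamma> = couplingD[OF coup]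
  have int: "integrable \<rho> \<phi>" "integrable \<mu> \<psi>" and feas: "\<And>x y. x \<in> X \<Longrightarrow> y \<in> Y \<Longrightarrow> \<phi> x + \<psi> y \<le> c (x, y)"
    using dual by (auto simp: dual_optimal_def dual_feasible_def space_\<rho> space_\<mu>)
  note i = integral_coupling[OF coup int]
  let ?D = "\<lambda>z. c z - (\<phi> (fst z) + \<psi> (snd z))"
  have D: "integrable \<gamma> ?D" using i(1) \<gamma>(10) by simp
  have nonneg: "AE z in \<gamma>. 0 \<le> ?D z" using feas \<gamma>(2) by (intro AE_I2) auto
  have "(LINT z|\<gamma>. c z) \<le> (LINT x|\<rho>. \<phi> x) + (LINT y|\<mu>. \<psi> y)"
    using strong_duality[OF opt] dual unfolding dual_optimal_def by (metis order_trans)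
  then have "(LINT z|\<gamma>. ?D z) \<le> 0" using i \<gamma>(10) by simp
  moreover have "(LINT z|\<gamma>. ?D z) \<ge> 0" using nonneg by (rule integral_nonneg_AE)
  ultimately have "AE z in \<gamma>. ?D z = 0" using integral_nonneg_eq_0_iff_AE[OF D nonneg] by simp
  then show ?thesis by (rule AE_mp) (auto intro!: AE_I2)
qed

text \<open>The transform is feasible and lies above \<open>\<phi>\<close>; optimality forbids a
  gain in the integral, so the two agree almost everywhere.\<close>

lemma dual_optimal_c_transform:
  assumes dual: "dual_optimal c \<rho> \<mu> \<phi> \<psi>"
  obtains \<phi>' where "continuous_on X \<phi>'" and "dual_optimal c \<rho> \<mu> \<phi>' \<psi>" and "AE x in \<rho>. \<phi> x = \<phi>' x"
proof -
  have int: "integrable \<rho> \<phi>" "integrable \<mu> \<psi>" and feas: "\<And>x y. x \<in> X \<Longrightarrow> y \<in> Y \<Longrightarrow> \<phi> x + \<psi> y \<le> c (x, y)"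
    using dual by (auto simp: dual_optimal_def dual_feasible_def space_\<rho> space_\<mu>)
  define \<phi>' where "\<phi>' x = (INF y\<in>Y. c (x, y) - \<psi> y)" for x
  note ct = c_transform[OF feas, simplified, folded \<phi>'_def]
  have int': "integrable \<rho> \<phi>'" by (rule integrable_continuous_\<rho>[OF ct(1)])
  have feas': "dual_feasible c \<rho> \<mu> \<phi>' \<psi>"
    using int' int(2) ct(2) by (simp add: dual_feasible_def space_\<rho> space_\<mu>)
  then have "(LINT x|\<rho>. \<phi>' x) \<le> (LINT x|\<rho>. \<phi> x)"
    using dual unfolding dual_optimal_def by (metis add_le_cancel_right)
  moreover have "(LINT x|\<rho>. \<phi> x) \<le> (LINT x|\<rho>. \<phi>' x)"
    using ct(3) by (intro integral_mono int int') (simp add: space_\<rho>)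
  ultimately have eq: "(LINT x|\<rho>. \<phi>' x) = (LINT x|\<rho>. \<phi> x)" by simp
  show thesis
  proof (rule that[OF ct(1)])
    show "dual_optimal c \<rho> \<mu> \<phi>' \<psi>" using dual feas' by (simp add: dual_optimal_def eq)
    have D: "integrable \<rho> (\<lambda>x. \<phi>' x - \<phi> x)" using int int' by simp
    have "AE x in \<rho>. 0 \<le> \<phi>' x - \<phi> x" using ct(3) by (intro AE_I2) (simp add: space_\<rho>)
    from integral_nonneg_eq_0_iff_AE[OF D this] eq have "AE x in \<rho>. \<phi>' x - \<phi> x = 0" using int int' by simp
    then show "AE x in \<rho>. \<phi> x = \<phi>' x" by (rule AE_mp) (auto intro!: AE_I2)
  qed
qed

text \<open>The second transform is taken against the new \<open>\<phi>'\<close> and leaves it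
  fixed, so the continuity gained first is kept.\<close>

lemma dual_optimal_continuous_version:
  assumes dual: "dual_optimal c \<rho> \<mu> \<phi> \<psi>"
  obtains \<phi>' \<psi>' where "continuous_on X \<phi>'" and "continuous_on Y \<psi>'" and "dual_optimal c \<rho> \<mu> \<phi>' \<psi>'"
    and "AE x in \<rho>. \<phi> x = \<phi>' x" and "AE y in \<mu>. \<psi> y = \<psi>' y"
proof -
  obtain \<phi>' where \<phi>': "continuous_on X \<phi>'" "dual_optimal c \<rho> \<mu> \<phi>' \<psi>" "AE x in \<rho>. \<phi> x = \<phi>' x"
    using dual_optimal_c_transform[OF dual] .
  obtain \<psi>' where \<psi>': "continuous_on Y \<psi>'" "dual_optimal (\<lambda>(y, x). c (x, y)) \<mu> \<rho> \<psi>' \<phi>'" "AE y in \<mu>. \<psi> y = \<psi>' y"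
    using transport_problem.dual_optimal_c_transform[OF swap dual_optimal_swap[OF \<phi>'(2)]] .
  from dual_optimal_swap[OF \<psi>'(2)] have "dual_optimal c \<rho> \<mu> \<phi>' \<psi>'" by simp
  then show thesis using that \<phi>' \<psi>' by blast
qed

end

section \<open>Contact sets\<close>

text \<open>This form serves either variable of the cost, the other one being a parameter in which
  the expansion is uniform. Linearity is demanded at all points because \<open>p t\<close> has to be
  linear also for \<open>t\<close> outside the unit interval.\<close>

definition uniform_partial_gradient :: "'a::real_normed_vector set \<Rightarrow> 'b set \<Rightarrow> ('a \<times> 'b \<Rightarrow> real)
    \<Rightarrow> ('a \<Rightarrow> 'b \<Rightarrow> 'a \<Rightarrow> real) \<Rightarrow> real \<Rightarrow> bool" where
  "uniform_partial_gradient X Y c D M \<longleftrightarrow> M \<ge> 0 \<and> (\<forall>x y. linear (D x y)) \<and>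
     (\<forall>x\<in>X. \<forall>y\<in>Y. \<forall>v. \<bar>D x y v\<bar> \<le> M * norm v) \<and>
     (\<forall>\<epsilon>>0. \<exists>\<delta>>0. \<forall>x\<in>X. \<forall>x'\<in>X. \<forall>y\<in>Y. norm (x' - x) \<le> \<delta> \<longrightarrow>
        \<bar>c (x', y) - c (x, y) - D x y (x' - x)\<bar> \<le> \<epsilon> * norm (x' - x))"

text \<open>The total derivative is restricted to the vectors \<open>(v, 0)\<close> and
  \<open>(0, v)\<close>, which have the norm of \<open>v\<close>; bound and expansion carry over
  with the same constants.\<close>

lemma C1_near_uniform_partial_gradient:
  fixes X :: "'a::real_normed_vector set" and Y :: "'b::real_normed_vector set"
  assumes C1: "C1_near (X \<times> Y) c" and cpt: "compact X" "compact Y"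
  shows "\<exists>D M. uniform_partial_gradient X Y c D M"
    and "\<exists>D M. uniform_partial_gradient Y X (\<lambda>(y, x). c (x, y)) D M"
proof -
  obtain f' :: "'a \<times> 'b \<Rightarrow> ('a \<times> 'b) \<Rightarrow>\<^sub>L real" and M where M: "M \<ge> 0" and f': "\<And>z. z \<in> X \<times> Y \<Longrightarrow> norm (f' z) \<le> M"
    and exp: "\<And>\<epsilon>. \<epsilon> > 0 \<Longrightarrow> \<exists>\<delta>>0. \<forall>z\<in>X \<times> Y. \<forall>z'\<in>X \<times> Y. norm (z' - z) \<le> \<delta> \<longrightarrow>
      \<bar>c z' - c z - blinfun_apply (f' z) (z' - z)\<bar> \<le> \<epsilon> * norm (z' - z)"
    using C1_near_compact_expansion[OF C1 compact_Times[OF cpt]] by metis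
  have bound: "\<bar>blinfun_apply (f' z) v\<bar> \<le> M * norm v" if "z \<in> X \<times> Y" for z v
    using norm_blinfun[of "f' z" v] mult_right_mono[OF f'[OF that] norm_ge_zero[of v]] by simp
  have lin: "linear (\<lambda>v. blinfun_apply (f' z) (v, 0))" "linear (\<lambda>v. blinfun_apply (f' z) (0, v))" for z
    using blinfun.add_right[of "f' z" "(_, 0)" "(_, 0)"] blinfun.scaleR_right[of "f' z" _ "(_, 0)"]
      blinfun.add_right[of "f' z" "(0, _)" "(0, _)"] blinfun.scaleR_right[of "f' z" _ "(0, _)"]
    by (auto intro!: linearI)
  have exp2: "\<exists>\<delta>>0. \<forall>x\<in>X. \<forall>x'\<in>X. \<forall>y\<in>Y. \<forall>y'\<in>Y. norm (x' - x, y' - y) \<le> \<delta> \<longrightarrow>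
      \<bar>c (x', y') - c (x, y) - blinfun_apply (f' (x, y)) (x' - x, y' - y)\<bar> \<le> \<epsilon> * norm (x' - x, y' - y)" if "\<epsilon> > 0" for \<epsilon>
    using exp[OF that] by fastforce
  have "uniform_partial_gradient X Y c (\<lambda>x y v. blinfun_apply (f' (x, y)) (v, 0)) M"
    unfolding uniform_partial_gradient_def
  proof (intro conjI allI ballI impI)
    fix \<epsilon> :: real assume "\<epsilon> > 0"
    then obtain \<delta> where "\<delta> > 0" and \<delta>: "\<And>x x' y y'. x \<in> X \<Longrightarrow> x' \<in> X \<Longrightarrow> y \<in> Y \<Longrightarrow> y' \<in> Y \<Longrightarrow> norm (x' - x, y' - y) \<le> \<delta> \<Longrightarrow>
      \<bar>c (x', y') - c (x, y) - blinfun_apply (f' (x, y)) (x' - x, y' - y)\<bar> \<le> \<epsilon> * norm (x' - x, y' - y)"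
      using exp2 by meson
    have "\<bar>c (x', y) - c (x, y) - blinfun_apply (f' (x, y)) (x' - x, 0)\<bar> \<le> \<epsilon> * norm (x' - x)"
      if "x \<in> X" "x' \<in> X" "y \<in> Y" "norm (x' - x) \<le> \<delta>" for x x' y
      using \<delta>[OF that(1-3) that(3)] that(4) by (simp add: norm_Pair)
    then show "\<exists>\<delta>>0. \<forall>x\<in>X. \<forall>x'\<in>X. \<forall>y\<in>Y. norm (x' - x) \<le> \<delta> \<longrightarrow>
        \<bar>c (x', y) - c (x, y) - blinfun_apply (f' (x, y)) (x' - x, 0)\<bar> \<le> \<epsilon> * norm (x' - x)"
      using \<open>\<delta> > 0\<close> by blast
  next
    show "\<bar>blinfun_apply (f' (x, y)) (v, 0)\<bar> \<le> M * norm v" if "x \<in> X" "y \<in> Y" for x y v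
      using bound[of "(x, y)" "(v, 0)"] that by (simp add: norm_Pair)
  qed (fact M lin)+
  then show "\<exists>D M. uniform_partial_gradient X Y c D M" by blast
  have "uniform_partial_gradient Y X (\<lambda>(y, x). c (x, y)) (\<lambda>y x v. blinfun_apply (f' (x, y)) (0, v)) M"
    unfolding uniform_partial_gradient_def prod.case
  proof (intro conjI allI ballI impI)
    fix \<epsilon> :: real assume "\<epsilon> > 0"
    then obtain \<delta> where "\<delta> > 0" and \<delta>: "\<And>x x' y y'. x \<in> X \<Longrightarrow> x' \<in> X \<Longrightarrow> y \<in> Y \<Longrightarrow> y' \<in> Y \<Longrightarrow> norm (x' - x, y' - y) \<le> \<delta> \<Longrightarrow>
      \<bar>c (x', y') - c (x, y) - blinfun_apply (f' (x, y)) (x' - x, y' - y)\<bar> \<le> \<epsilon> * norm (x' - x, y' - y)"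
      using exp2 by meson
    have "\<bar>c (x, y') - c (x, y) - blinfun_apply (f' (x, y)) (0, y' - y)\<bar> \<le> \<epsilon> * norm (y' - y)"
      if "y \<in> Y" "y' \<in> Y" "x \<in> X" "norm (y' - y) \<le> \<delta>" for x y y'
      using \<delta>[OF that(3) that(3) that(1,2)] that(4) by (simp add: norm_Pair)
    then show "\<exists>\<delta>>0. \<forall>y\<in>Y. \<forall>y'\<in>Y. \<forall>x\<in>X. norm (y' - y) \<le> \<delta> \<longrightarrow>
        \<bar>c (x, y') - c (x, y) - blinfun_apply (f' (x, y)) (0, y' - y)\<bar> \<le> \<epsilon> * norm (y' - y)"
      using \<open>\<delta> > 0\<close> by blast
  next
    show "\<bar>blinfun_apply (f' (x, y)) (0, v)\<bar> \<le> M * norm v" if "y \<in> Y" "x \<in> X" for x y v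
      using bound[of "(x, y)" "(0, v)"] that by (simp add: norm_Pair)
  qed (fact M lin)+
  then show "\<exists>D M. uniform_partial_gradient Y X (\<lambda>(y, x). c (x, y)) D M" by blast
qed

text \<open>Both potentials touch the cost at the same \<open>y\<close>. This gives them one common
  gradient there, so the first-order term drops out of their difference up to the gap between two
  such gradients.\<close>

lemma contact_difference_constant:
  fixes X :: "'a::real_inner set"
  assumes grad: "uniform_partial_gradient X Y c D M"
    and feas: "\<And>x y. x \<in> X \<Longrightarrow> y \<in> Y \<Longrightarrow> \<phi>\<^sub>0 x + \<psi>\<^sub>0 y \<le> c (x, y)" "\<And>x y. x \<in> X \<Longrightarrow> y \<in> Y \<Longrightarrow> \<phi>\<^sub>1 x + \<psi>\<^sub>1 y \<le> c (x, y)"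
    and contact: "\<And>x. x \<in> A \<Longrightarrow> \<exists>y\<in>Y. \<phi>\<^sub>0 x + \<psi>\<^sub>0 y = c (x, y) \<and> \<phi>\<^sub>1 x + \<psi>\<^sub>1 y = c (x, y)"
    and A: "A \<subseteq> X" "lipschitz_path_connected A" "a \<in> A" "b \<in> A"
  shows "\<phi>\<^sub>0 b - \<phi>\<^sub>1 b = \<phi>\<^sub>0 a - \<phi>\<^sub>1 a"
proof -
  obtain w where w: "path w" "path_image w \<subseteq> A" "pathstart w = a" "pathfinish w = b" "finite_length w"
    using A unfolding lipschitz_path_connected_def by blast
  have wA: "w t \<in> A" if "t \<in> {0..1}" for t
    using w(2) that by (auto simp: path_image_def)
  have wX: "w t \<in> X" if "t \<in> {0..1}" for t using wA[OF that] A(1) by blast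
  have "\<forall>t\<in>{0..1}. \<exists>y\<in>Y. \<phi>\<^sub>0 (w t) + \<psi>\<^sub>0 y = c (w t, y) \<and> \<phi>\<^sub>1 (w t) + \<psi>\<^sub>1 y = c (w t, y)"
    using contact wA by blast
  then obtain y where y: "\<And>t. t \<in> {0..1} \<Longrightarrow> y t \<in> Y"
    and eq: "\<And>t. t \<in> {0..1} \<Longrightarrow> \<phi>\<^sub>0 (w t) + \<psi>\<^sub>0 (y t) = c (w t, y t)" "\<And>t. t \<in> {0..1} \<Longrightarrow> \<phi>\<^sub>1 (w t) + \<psi>\<^sub>1 (y t) = c (w t, y t)"
    by (metis bchoice)
  define p where "p t = D (w t) (y t)" for t
  define h where "h t = \<phi>\<^sub>0 (w t) - \<phi>\<^sub>1 (w t)" for t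
  have "h 1 = h 0"
  proof (rule endpoint_eq_of_increment_bound[OF w(1,5)])
    show "M \<ge> 0" "\<And>t. linear (p t)" using grad by (auto simp: uniform_partial_gradient_def p_def)
    show "\<bar>p t v\<bar> \<le> M * norm v" if "t \<in> {0..1}" for t v
      using grad wX[OF that] y[OF that] by (simp add: uniform_partial_gradient_def p_def)
    fix \<epsilon> :: real assume \<epsilon>: "\<epsilon> > 0"
    have lin: "linear (p t)" for t using grad by (simp add: uniform_partial_gradient_def p_def)
    obtain \<delta> where "\<delta> > 0" and \<delta>: "\<And>x x' y. x \<in> X \<Longrightarrow> x' \<in> X \<Longrightarrow> y \<in> Y \<Longrightarrow> norm (x' - x) \<le> \<delta> \<Longrightarrow>
        \<bar>c (x', y) - c (x, y) - D x y (x' - x)\<bar> \<le> \<epsilon> / 2 * norm (x' - x)"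
      using grad half_gt_zero[OF \<epsilon>] unfolding uniform_partial_gradient_def by meson
    \<comment> \<open>Feasibility at \<open>(w s, y t)\<close> minus equality at
      \<open>(w t, y t)\<close> leaves \<open>c (w s, y t) - c (w t, y t)\<close> for both
      potentials. Exchanging \<open>s\<close> and \<open>t\<close> gives the lower bound, and the
      two errors add up to \<open>\<epsilon>\<close>.\<close>
    have upper: "\<phi>\<^sub>0 (w s) - \<phi>\<^sub>0 (w t) \<le> p t (w s - w t) + \<epsilon> / 2 * norm (w s - w t) \<and>
        \<phi>\<^sub>1 (w s) - \<phi>\<^sub>1 (w t) \<le> p t (w s - w t) + \<epsilon> / 2 * norm (w s - w t)"
      if st: "s \<in> {0..1}" "t \<in> {0..1}" "norm (w s - w t) \<le> \<delta>" for s t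
      using \<delta>[OF wX wX y st(3), OF st(2,1,2)] feas[OF wX y, OF st(1,2)] eq[OF st(2)]
      unfolding p_def by linarith
    have "\<bar>h s - h t\<bar> \<le> p t (w s - w t) - p s (w s - w t) + \<epsilon> * norm (w s - w t)"
      if st: "s \<in> {0..1}" "t \<in> {0..1}" "norm (w s - w t) \<le> \<delta>" for s t
    proof -
      have ts: "norm (w t - w s) \<le> \<delta>" using st(3) by (simp add: norm_minus_commute)
      have neg: "p s (w t - w s) = - p s (w s - w t)"
        using linear_neg[OF lin, of s "w s - w t"] by simp
      show ?thesis
        using upper[OF st] upper[OF st(2,1) ts] unfolding neg norm_minus_commute[of "w t"] h_def
        by (simp add: abs_le_iff)
    qed
    then show "\<exists>\<delta>>0. \<forall>s\<in>{0..1}. \<forall>t\<in>{0..1}. norm (w s - w t) \<le> \<delta> \<longrightarrow>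
        \<bar>h s - h t\<bar> \<le> p t (w s - w t) - p s (w s - w t) + \<epsilon> * norm (w s - w t)"
      using \<open>\<delta> > 0\<close> by blast
  qed
  then show ?thesis using w(3,4) by (simp add: h_def pathstart_def pathfinish_def)
qed

context transport_problem
begin

text \<open>Projections of the compact contact set are closed and have full marginal measure, so
  their complements are open null sets and miss the support. Contact thus holds at every point of
  the support, as required along curves, which may be null sets.\<close>

lemma Supp_contact:
  assumes \<phi>: "continuous_on X \<phi>\<^sub>0" "continuous_on X \<phi>\<^sub>1" and \<psi>: "continuous_on Y \<psi>\<^sub>0" "continuous_on Y \<psi>\<^sub>1"
    and opt: "optimal_coupling c \<rho> \<mu> \<gamma>"
    and dual: "dual_optimal c \<rho> \<mu> \<phi>\<^sub>0 \<psi>\<^sub>0" "dual_optimal c \<rho> \<mu> \<phi>\<^sub>1 \<psi>\<^sub>1"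
  shows "x \<in> Supp \<rho> \<Longrightarrow> \<exists>y\<in>Y. \<phi>\<^sub>0 x + \<psi>\<^sub>0 y = c (x, y) \<and> \<phi>\<^sub>1 x + \<psi>\<^sub>1 y = c (x, y)"
    and "y \<in> Supp \<mu> \<Longrightarrow> \<exists>x\<in>X. \<phi>\<^sub>0 x + \<psi>\<^sub>0 y = c (x, y) \<and> \<phi>\<^sub>1 x + \<psi>\<^sub>1 y = c (x, y)"
proof -
  have coup: "\<gamma> \<in> couplings \<rho> \<mu>" using opt by (simp add: optimal_coupling_def)
  note \<gamma> = couplingD[OF coup]
  define K where "K = {z \<in> X \<times> Y. \<phi>\<^sub>0 (fst z) + \<psi>\<^sub>0 (snd z) - c z = 0} \<inter> {z \<in> X \<times> Y. \<phi>\<^sub>1 (fst z) + \<psi>\<^sub>1 (snd z) - c z = 0}"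
  have closedin: "closedin (top_of_set (X \<times> Y)) {z \<in> X \<times> Y. f (fst z) + g (snd z) - c z = 0}"
    if "continuous_on X f" "continuous_on Y g" for f g :: "_ \<Rightarrow> real"
  proof (rule continuous_closedin_preimage_constant)
    show "continuous_on (X \<times> Y) (\<lambda>z. f (fst z) + g (snd z) - c z)"
      by (intro continuous_intros continuous_cost continuous_on_compose2[OF that(1)] continuous_on_compose2[OF that(2)]) auto
  qed
  have "compact K"
    unfolding K_def using closedin \<phi> \<psi> compact_Times[OF compact_X compact_Y]
    by (intro closedin_compact[OF _ closedin_Int]) auto
  then have closed: "closed (fst ` K)" "closed (snd ` K)"
    by (auto intro!: compact_imp_closed compact_continuous_image continuous_intros)
  have AE_K: "AE z in \<gamma>. z \<in> K"
    using complementary_slackness[OF opt dual(1)] complementary_slackness[OF opt dual(2)] AE_space[of \<gamma>]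
    by eventually_elim (simp add: K_def \<gamma>(2))
  have Supp: "Supp M \<subseteq> g ` K" if closed: "closed (g ` K)" and g: "g \<in> \<gamma> \<rightarrow>\<^sub>M M" and d: "distr \<gamma> M g = M"
    and id: "(\<lambda>x. x) \<in> M \<rightarrow>\<^sub>M borel" for g and M :: "'m::topological_space measure"
  proof
    fix x assume x: "x \<in> Supp M"
    show "x \<in> g ` K"
    proof (rule ccontr)
      assume "x \<notin> g ` K"
      let ?U = "- (g ` K) \<inter> space M"
      have "?U \<in> sets M" using measurable_sets[OF id, of "- (g ` K)"] closed by auto
      then have "emeasure M ?U = emeasure \<gamma> (g -` ?U \<inter> space \<gamma>)"
        using emeasure_distr[OF g, of ?U] d by simp
      also have "\<dots> = 0"
      proof -
        have "AE z in \<gamma>. g z \<notin> ?U" using AE_K by (rule AE_mp) (auto intro!: AE_I2)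
        from emeasure_eq_0_AE[OF this] show ?thesis by (simp add: vimage_def Int_def conj_commute)
      qed
      finally show False using x \<open>x \<notin> g ` K\<close> closed unfolding Supp_def by (force simp: open_Compl)
    qed
  qed
  have K: "\<phi>\<^sub>0 (fst z) + \<psi>\<^sub>0 (snd z) = c z" "\<phi>\<^sub>1 (fst z) + \<psi>\<^sub>1 (snd z) = c z" "fst z \<in> X" "snd z \<in> Y" if "z \<in> K" for z
    using that by (auto simp: K_def)
  show "\<exists>y\<in>Y. \<phi>\<^sub>0 x + \<psi>\<^sub>0 y = c (x, y) \<and> \<phi>\<^sub>1 x + \<psi>\<^sub>1 y = c (x, y)" if "x \<in> Supp \<rho>"
  proof -
    have "x \<in> fst ` K" using Supp[OF closed(1) \<gamma>(6,4) borel_prob_onD(3)[OF \<rho>]] that by blast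
    then obtain z where "z \<in> K" "x = fst z" by blast
    then show ?thesis using K[of z] by (intro bexI[of _ "snd z"]) auto
  qed
  show "\<exists>x\<in>X. \<phi>\<^sub>0 x + \<psi>\<^sub>0 y = c (x, y) \<and> \<phi>\<^sub>1 x + \<psi>\<^sub>1 y = c (x, y)" if "y \<in> Supp \<mu>"
  proof -
    have "y \<in> snd ` K" using Supp[OF closed(2) \<gamma>(7,5) borel_prob_onD(3)[OF \<mu>]] that by blast
    then obtain z where "z \<in> K" "y = snd z" by blast
    then show ?thesis using K[of z] by (intro bexI[of _ "fst z"]) auto
  qed
qed

section \<open>Propagation of the constants through the graph\<close>

lemma dual_unique:
  assumes C1: "C1_near (X \<times> Y) c"
    and conn: "Digraph_Component.connected (with_proj (transport_graph c \<rho> \<mu>))"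
    and dual: "dual_optimal c \<rho> \<mu> \<phi>\<^sub>0 \<psi>\<^sub>0" "dual_optimal c \<rho> \<mu> \<phi>\<^sub>1 \<psi>\<^sub>1"
    and \<phi>: "continuous_on X \<phi>\<^sub>0" "continuous_on X \<phi>\<^sub>1" and \<psi>: "continuous_on Y \<psi>\<^sub>0" "continuous_on Y \<psi>\<^sub>1"
  shows "\<exists>l. (\<forall>x\<in>Supp \<rho>. \<phi>\<^sub>0 x = \<phi>\<^sub>1 x + l) \<and> (\<forall>y\<in>Supp \<mu>. \<psi>\<^sub>0 y = \<psi>\<^sub>1 y - l)"
proof -
  let ?VX = "lipschitz_path_components (Supp \<rho>)" and ?VY = "lipschitz_path_components (Supp \<mu>)"
  let ?G = "mk_symmetric (with_proj (transport_graph c \<rho> \<mu>))"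
  have AE_X: "AE x in \<rho>. x \<in> Supp \<rho>" and AE_Y: "AE y in \<mu>. y \<in> Supp \<mu>"
    using AE_in_Supp borel_prob_onD(3) \<rho> \<mu> by blast+
  have "Supp \<rho> \<noteq> {}" "Supp \<mu> \<noteq> {}" using AE_X AE_Y by auto
  then obtain x0 y0 where x0: "x0 \<in> Supp \<rho>" and y0: "y0 \<in> Supp \<mu>" by blast
  obtain A0 where A0: "A0 \<in> ?VX" "x0 \<in> A0" using lipschitz_path_components_cover[OF x0] .
  obtain B0 where B0: "B0 \<in> ?VY" "y0 \<in> B0" using lipschitz_path_components_cover[OF y0] .
  have reach: "u \<rightarrow>\<^sup>*\<^bsub>with_proj ?G\<^esub> v" if "u \<in> ?VX <+> ?VY" "v \<in> ?VX <+> ?VY" for u v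
    using conn that unfolding connected_def strongly_connected_def by (simp add: transport_graph_def)
  have arc: "\<exists>A B \<gamma>. A \<in> ?VX \<and> B \<in> ?VY \<and> {u, v} = {Inl A, Inr B} \<and> optimal_coupling c \<rho> \<mu> \<gamma> \<and> emeasure \<gamma> (A \<times> B) > 0"
    if "u \<rightarrow>\<^bsub>with_proj ?G\<^esub> v" for u v
    using that by (auto simp: parcs_mk_symmetric transport_graph_def)
  \<comment> \<open>The graph has a vertex of either kind. These are distinct, so a walk between
    them has a first arc, and its witness is an optimal coupling.\<close>
  have "\<exists>\<gamma>. optimal_coupling c \<rho> \<mu> \<gamma>"
  proof -
    have "Inl A0 \<rightarrow>\<^sup>*\<^bsub>with_proj ?G\<^esub> Inr B0" using A0 B0 by (intro reach) auto
    then obtain v where "Inl A0 \<rightarrow>\<^bsub>with_proj ?G\<^esub> v"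
      by (rule pre_digraph.converse_reachable_cases) auto
    then show ?thesis using arc by blast
  qed
  then obtain \<gamma> where opt: "optimal_coupling c \<rho> \<mu> \<gamma>" by blast
  have feas: "\<And>x y. x \<in> X \<Longrightarrow> y \<in> Y \<Longrightarrow> \<phi>\<^sub>0 x + \<psi>\<^sub>0 y \<le> c (x, y)" "\<And>x y. x \<in> X \<Longrightarrow> y \<in> Y \<Longrightarrow> \<phi>\<^sub>1 x + \<psi>\<^sub>1 y \<le> c (x, y)"
    using dual by (auto simp: dual_optimal_def dual_feasible_def space_\<rho> space_\<mu>)
  have SX: "Supp \<rho> \<subseteq> X" and SY: "Supp \<mu> \<subseteq> Y" by (auto simp: Supp_def space_\<rho> space_\<mu>)
  note contact = Supp_contact[OF \<phi> \<psi> opt dual]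
  have constX: "\<phi>\<^sub>0 b - \<phi>\<^sub>1 b = \<phi>\<^sub>0 a - \<phi>\<^sub>1 a" if A: "A \<in> ?VX" "a \<in> A" "b \<in> A" for A a b
  proof -
    obtain D M where "uniform_partial_gradient X Y c D M"
      using C1_near_uniform_partial_gradient(1)[OF C1 compact_X compact_Y] by blast
    moreover have "A \<subseteq> Supp \<rho>" "lipschitz_path_connected A" using A(1) by (auto simp: lipschitz_path_components_def)
    ultimately show ?thesis
      using contact(1) SX A(2,3) by (intro contact_difference_constant[where \<phi>\<^sub>0 = \<phi>\<^sub>0 and \<phi>\<^sub>1 = \<phi>\<^sub>1 and \<psi>\<^sub>0 = \<psi>\<^sub>0 and \<psi>\<^sub>1 = \<psi>\<^sub>1
            and A = A and X = X and Y = Y and c = c, OF _ feas]) auto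
  qed
  have constY: "\<psi>\<^sub>0 b - \<psi>\<^sub>1 b = \<psi>\<^sub>0 a - \<psi>\<^sub>1 a" if B: "B \<in> ?VY" "a \<in> B" "b \<in> B" for B a b
  proof -
    obtain D M where grad: "uniform_partial_gradient Y X (\<lambda>(y, x). c (x, y)) D M"
      using C1_near_uniform_partial_gradient(2)[OF C1 compact_X compact_Y] by blast
    have sub: "B \<subseteq> Supp \<mu>" "lipschitz_path_connected B" using B(1) by (auto simp: lipschitz_path_components_def)
    show ?thesis
    proof (rule contact_difference_constant[OF grad _ _ _ _ sub(2) B(2,3)])
      show "\<psi>\<^sub>0 y + \<phi>\<^sub>0 x \<le> (\<lambda>(y, x). c (x, y)) (y, x)" "\<psi>\<^sub>1 y + \<phi>\<^sub>1 x \<le> (\<lambda>(y, x). c (x, y)) (y, x)" if "y \<in> Y" "x \<in> X" for x y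
        using feas that by (simp_all add: add.commute)
      show "\<exists>x\<in>X. \<psi>\<^sub>0 y + \<phi>\<^sub>0 x = (\<lambda>(y, x). c (x, y)) (y, x) \<and> \<psi>\<^sub>1 y + \<phi>\<^sub>1 x = (\<lambda>(y, x). c (x, y)) (y, x)" if "y \<in> B" for y
        using contact(2)[of y] that sub(1) by (auto simp: add.commute)
      show "B \<subseteq> Y" using sub(1) SY by blast
    qed
  qed
  \<comment> \<open>The opposite signs on the two sides make the values at both ends of an edge
    equal: subtracting the two contact equations gives \<open>\<phi>\<^sub>0 x - \<phi>\<^sub>1 x =
    \<psi>\<^sub>1 y - \<psi>\<^sub>0 y\<close>.\<close>
  define F where "F u = (case u of Inl A \<Rightarrow> (SOME l. \<forall>x\<in>A. \<phi>\<^sub>0 x - \<phi>\<^sub>1 x = l) | Inr B \<Rightarrow> (SOME l. \<forall>y\<in>B. \<psi>\<^sub>1 y - \<psi>\<^sub>0 y = l))" for u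
  have FX: "\<phi>\<^sub>0 x - \<phi>\<^sub>1 x = F (Inl A)" if "A \<in> ?VX" "x \<in> A" for A x
  proof -
    have "\<exists>l. \<forall>x\<in>A. \<phi>\<^sub>0 x - \<phi>\<^sub>1 x = l" using constX[OF that(1) that(2)] by blast
    from someI_ex[OF this] show ?thesis using that(2) unfolding F_def sum.case by blast
  qed
  have FY: "\<psi>\<^sub>1 y - \<psi>\<^sub>0 y = F (Inr B)" if "B \<in> ?VY" "y \<in> B" for B y
  proof -
    have "\<psi>\<^sub>1 z - \<psi>\<^sub>0 z = \<psi>\<^sub>1 y - \<psi>\<^sub>0 y" if "z \<in> B" for z using constY[OF \<open>B \<in> ?VY\<close> \<open>y \<in> B\<close> that] by simp
    then have "\<exists>l. \<forall>y\<in>B. \<psi>\<^sub>1 y - \<psi>\<^sub>0 y = l" by blast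
    from someI_ex[OF this] show ?thesis using that(2) unfolding F_def sum.case by blast
  qed
  have edge: "F u = F v" if uv: "u \<rightarrow>\<^bsub>with_proj ?G\<^esub> v" for u v
  proof -
    obtain A B \<gamma>' where AB: "A \<in> ?VX" "B \<in> ?VY" "{u, v} = {Inl A, Inr B}"
      and opt': "optimal_coupling c \<rho> \<mu> \<gamma>'" and pos: "emeasure \<gamma>' (A \<times> B) > 0"
      using arc[OF uv] by blast
    have "\<exists>z\<in>A \<times> B. \<phi>\<^sub>0 (fst z) + \<psi>\<^sub>0 (snd z) = c z \<and> \<phi>\<^sub>1 (fst z) + \<psi>\<^sub>1 (snd z) = c z"
    proof (rule ccontr)
      assume neg: "\<not> ?thesis"
      have "AE z in \<gamma>'. z \<notin> A \<times> B"
        using complementary_slackness[OF opt' dual(1)] complementary_slackness[OF opt' dual(2)]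
        by eventually_elim (use neg in blast)
      moreover have "A \<times> B \<subseteq> space \<gamma>'"
        using AB(1,2) SX SY couplingD(2)[of \<gamma>'] opt'
        by (auto simp: lipschitz_path_components_def optimal_coupling_def)
      then have "{z \<in> space \<gamma>'. z \<in> A \<times> B} = A \<times> B" by blast
      \<comment> \<open>Measurability of \<open>A \<times> B\<close> is no concern:
        \<open>emeasure\<close> is 0 on nonmeasurable sets, so the contradiction arises in either
        case.\<close>
      ultimately have "emeasure \<gamma>' (A \<times> B) = 0" using emeasure_eq_0_AE[of "\<lambda>z. z \<in> A \<times> B" \<gamma>'] by simp
      then show False using pos by simp
    qed
    then obtain x y where "x \<in> A" "y \<in> B" "\<phi>\<^sub>0 x + \<psi>\<^sub>0 y = c (x, y)" "\<phi>\<^sub>1 x + \<psi>\<^sub>1 y = c (x, y)" by auto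
    then have "F (Inl A) = F (Inr B)" using FX[OF AB(1)] FY[OF AB(2)] by fastforce
    then show ?thesis using AB(3) by (auto simp: doubleton_eq_iff)
  qed
  have F: "F u = F (Inl A0)" if "u \<in> ?VX <+> ?VY" for u
  proof -
    have "Inl A0 \<rightarrow>\<^sup>*\<^bsub>with_proj ?G\<^esub> u" using A0 that by (intro reach) auto
    then show ?thesis
      unfolding reachable_def by (induction rule: rtrancl_on.induct) (blast, metis edge)
  qed
  show ?thesis
  proof (intro exI[of _ "F (Inl A0)"] conjI ballI)
    fix x assume "x \<in> Supp \<rho>"
    then obtain A where A: "A \<in> ?VX" "x \<in> A" by (rule lipschitz_path_components_cover)
    then show "\<phi>\<^sub>0 x = \<phi>\<^sub>1 x + F (Inl A0)" using FX[OF A] F[OF InlI[OF A(1)]] by linarith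
  next
    fix y assume "y \<in> Supp \<mu>"
    then obtain B where B: "B \<in> ?VY" "y \<in> B" by (rule lipschitz_path_components_cover)
    then show "\<psi>\<^sub>0 y = \<psi>\<^sub>1 y - F (Inl A0)" using FY[OF B] F[OF InrI[OF B(1)]] by linarith
  qed
qed

end

theorem theorem5p12:
  fixes X Y :: "(real ^ 'd) set"
    and \<rho> \<mu> :: "(real ^ 'd) measure"
    and c :: "(real ^ 'd) \<times> (real ^ 'd) \<Rightarrow> real"
    and \<phi>\<^sub>0 \<phi>\<^sub>1 \<psi>\<^sub>0 \<psi>\<^sub>1 :: "real ^ 'd \<Rightarrow> real"
  assumes "compact X" and "compact Y"
    and "borel_prob_on X \<rho>" and "borel_prob_on Y \<mu>"
    and "C1_near (X \<times> Y) c"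
    and "finite (lipschitz_path_components (Supp \<rho>))"
    and "finite (lipschitz_path_components (Supp \<mu>))"
    and "Digraph_Component.connected (with_proj (transport_graph c \<rho> \<mu>))"
    and "dual_optimal c \<rho> \<mu> \<phi>\<^sub>0 \<psi>\<^sub>0" and "dual_optimal c \<rho> \<mu> \<phi>\<^sub>1 \<psi>\<^sub>1"
  shows "\<exists>l::real. (AE x in \<rho>. \<phi>\<^sub>0 x = \<phi>\<^sub>1 x + l) \<and> (AE y in \<mu>. \<psi>\<^sub>0 y = \<psi>\<^sub>1 y - l)"
proof -
  have "continuous_on (X \<times> Y) c"
    using C1_near_compact_expansion[OF assms(5) compact_Times[OF assms(1,2)]] by metis
  then interpret transport_problem X Y \<rho> \<mu> c using assms(1-4) by unfold_locales
  obtain f0 g0 where f0: "continuous_on X f0" "continuous_on Y g0" "dual_optimal c \<rho> \<mu> f0 g0"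
    and eq0: "AE x in \<rho>. \<phi>\<^sub>0 x = f0 x" "AE y in \<mu>. \<psi>\<^sub>0 y = g0 y"
    using dual_optimal_continuous_version[OF assms(9)] .
  obtain f1 g1 where f1: "continuous_on X f1" "continuous_on Y g1" "dual_optimal c \<rho> \<mu> f1 g1"
    and eq1: "AE x in \<rho>. \<phi>\<^sub>1 x = f1 x" "AE y in \<mu>. \<psi>\<^sub>1 y = g1 y"
    using dual_optimal_continuous_version[OF assms(10)] .
  obtain l where l: "\<forall>x\<in>Supp \<rho>. f0 x = f1 x + l" "\<forall>y\<in>Supp \<mu>. g0 y = g1 y - l"
    using dual_unique[OF assms(5,8) f0(3) f1(3) f0(1) f1(1) f0(2) f1(2)] by blast
  have S: "AE x in \<rho>. x \<in> Supp \<rho>" "AE y in \<mu>. y \<in> Supp \<mu>"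
    using AE_in_Supp borel_prob_onD(3) \<rho> \<mu> by blast+
  have "AE x in \<rho>. \<phi>\<^sub>0 x = \<phi>\<^sub>1 x + l"
    using eq0(1) eq1(1) S(1) by eventually_elim (use l in simp)
  moreover have "AE y in \<mu>. \<psi>\<^sub>0 y = \<psi>\<^sub>1 y - l"
    using eq0(2) eq1(2) S(2) by eventually_elim (use l in simp)
  ultimately show ?thesis by blast
qed

end
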